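(* Let $0<H<1$, $0<K\leq 1$ and $T>0$. Let $W^{H,K}$ be a bifractional Brownian motion with parameters $H,K$, and let $Y^{(1)}_t=2^{(1-K)/2}W^{HK}(t)$, $0\leq t\leq T$, where $W^{HK}$ is a fractional Brownian motion with Hurst index $HK$. Let $m:[0,T]\to\mathbb{R}$ be any continuous function and $c\in\mathbb{R}$ an arbitrary constant. Then $$E\Big[\sup_{0\leq t\leq T}\{W_t^{H,K}+m(t),c\}\Big]\leq E\Big[\sup_{0\leq t\leq T}\{Y_t^{(1)}+m(t),c\}\Big].$$ In addition, if $g:\mathbb{R}\to\mathbb{R}$ is a non-decreasing convex function, then $$E\Big[g\Big(\sup_{0\leq t\leq T}(W_t^{H,K}+m(t))\Big)\Big]\leq E\Big[g\Big(\sup_{0\leq t\leq T}(Y_t^{(1)}+m(t))\Big)\Big].$$ Moreover, for any $0\leq t\leq T$, $$\int_t^\infty P\Big(\sup_{0\leq s\leq T}W_s^{H,K}>u\Big)\,du\leq\int_t^\infty P\Big(\sup_{0\leq s\leq T}Y_s^{(1)}>u\Big)\,du,$$ or equivalently, for any $0\leq t\leq T$, $$E\Big[\sup_{0\leq s\leq T}W_s^{H,K}-t\Big]_+\leq E\Big[\sup_{0\leq s\leq T}Y_s^{(1)}-t\Big]_+.$$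
   Context: A bifractional Brownian motion with parameters $H\in(0,1)$, $K\in(0,1]$ is a centered Gaussian process $\{W_t^{H,K},t\geq 0\}$ with covariance function $$C_H(s,t)=\frac{1}{2^K}\big[(t^{2H}+s^{2H})^K-|s-t|^{2HK}\big].$$ A fractional Brownian motion with Hurst index $h\in(0,1)$ is a centered Gaussian process with covariance function $\frac12(t^{2h}+s^{2h}-|t-s|^{2h})$; here $h=HK$. All processes are assumed to have almost surely continuous sample paths on $[0,T]$. For a process $Z$ and a constant $c$, $\sup_{0\leq t\leq T}\{Z_t,c\}$ denotes $\max\{\sup_{0\leq t\leq T}Z_t,\,c\}$. $E[\xi]_+$ denotes $E[\max(\xi,0)]$. *)

theory Defs
  imports "HOL-Probability.Probability"
begin

(* The first disjunct is the degenerate law N(\<mu>, 0); it is needed, e.g., for the value at time 0. *)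
definition gaussian_rv :: "'a measure \<Rightarrow> ('a \<Rightarrow> real) \<Rightarrow> bool" where
  "gaussian_rv M X \<longleftrightarrow> X \<in> borel_measurable M \<and>
     ((\<exists>\<mu>. AE x in M. X x = \<mu>) \<or>
      (\<exists>\<mu> \<sigma>. 0 < \<sigma> \<and> distributed M lborel X (normal_density \<mu> \<sigma>)))"

(* All finite-dimensional distributions are jointly Gaussian: every finite linear combination
   of the Z t is a (possibly degenerate) Gaussian random variable. *)
definition gaussian_process :: "'a measure \<Rightarrow> 'i set \<Rightarrow> ('i \<Rightarrow> 'a \<Rightarrow> real) \<Rightarrow> bool" where
  "gaussian_process M I Z \<longleftrightarrow> prob_space M \<and>
     (\<forall>F a. finite F \<and> F \<subseteq> I \<longrightarrow> gaussian_rv M (\<lambda>x. \<Sum>t\<in>F. a t * Z t x))"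

definition covariance :: "'a measure \<Rightarrow> ('a \<Rightarrow> real) \<Rightarrow> ('a \<Rightarrow> real) \<Rightarrow> real" where
  "covariance M X Y = (\<integral>x. (X x - (\<integral>y. X y \<partial>M)) * (Y x - (\<integral>y. Y y \<partial>M)) \<partial>M)"

definition centered_gaussian_process ::
    "'a measure \<Rightarrow> 'i set \<Rightarrow> ('i \<Rightarrow> 'i \<Rightarrow> real) \<Rightarrow> ('i \<Rightarrow> 'a \<Rightarrow> real) \<Rightarrow> bool" where
  "centered_gaussian_process M I C Z \<longleftrightarrow> gaussian_process M I Z \<and>
     (\<forall>t\<in>I. (\<integral>x. Z t x \<partial>M) = 0) \<and>
     (\<forall>s\<in>I. \<forall>t\<in>I. covariance M (Z s) (Z t) = C s t)"

(* All exponents below are positive, so the convention 0 powr a = 0 is the usual one. *)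
definition bifractional_cov :: "real \<Rightarrow> real \<Rightarrow> real \<Rightarrow> real \<Rightarrow> real" where
  "bifractional_cov H K s t =
     1 / 2 powr K * ((t powr (2*H) + s powr (2*H)) powr K - \<bar>s - t\<bar> powr (2*H*K))"

definition fractional_cov :: "real \<Rightarrow> real \<Rightarrow> real \<Rightarrow> real" where
  "fractional_cov h s t = 1 / 2 * (t powr (2*h) + s powr (2*h) - \<bar>t - s\<bar> powr (2*h))"

definition bifractional_BM :: "'a measure \<Rightarrow> real \<Rightarrow> real \<Rightarrow> (real \<Rightarrow> 'a \<Rightarrow> real) \<Rightarrow> bool" where
  "bifractional_BM M H K W \<longleftrightarrow> 0 < H \<and> H < 1 \<and> 0 < K \<and> K \<le> 1 \<and>
     centered_gaussian_process M {0..} (bifractional_cov H K) W"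

definition fractional_BM :: "'a measure \<Rightarrow> real \<Rightarrow> (real \<Rightarrow> 'a \<Rightarrow> real) \<Rightarrow> bool" where
  "fractional_BM M h B \<longleftrightarrow> 0 < h \<and> h < 1 \<and>
     centered_gaussian_process M {0..} (fractional_cov h) B"

definition ae_continuous_paths :: "'a measure \<Rightarrow> real \<Rightarrow> (real \<Rightarrow> 'a \<Rightarrow> real) \<Rightarrow> bool" where
  "ae_continuous_paths M T Z \<longleftrightarrow> (AE x in M. continuous_on {0..T} (\<lambda>t. Z t x))"

(* Expectation with values in the extended reals, E f = E f^+ - E f^-, since E g(sup ...) may be
   infinite. It is meaningful only under has_expectation, which excludes \<infinity> - \<infinity>.
   Paths are continuous only almost surely, so suprema over uncountable sets are measurable only
   up to a null set; hence the completion of M. The ennreal coercion truncates at 0. *)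
definition has_expectation :: "'a measure \<Rightarrow> ('a \<Rightarrow> real) \<Rightarrow> bool" where
  "has_expectation M f \<longleftrightarrow> f \<in> borel_measurable (completion M) \<and>
     ((\<integral>\<^sup>+x. ennreal (f x) \<partial>completion M) < \<infinity> \<or> (\<integral>\<^sup>+x. ennreal (- f x) \<partial>completion M) < \<infinity>)"

definition ext_expectation :: "'a measure \<Rightarrow> ('a \<Rightarrow> real) \<Rightarrow> ereal" where
  "ext_expectation M f =
     enn2ereal (\<integral>\<^sup>+x. ennreal (f x) \<partial>completion M) - enn2ereal (\<integral>\<^sup>+x. ennreal (- f x) \<partial>completion M)"

(* The real-valued supremum takes an unspecified value on unbounded paths, which form a null set
   for processes with almost surely continuous paths. *)
definition path_sup :: "real \<Rightarrow> (real \<Rightarrow> 'a \<Rightarrow> real) \<Rightarrow> 'a \<Rightarrow> real" where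
  "path_sup T Z x = (SUP t\<in>{0..T}. Z t x)"

definition tail_integral :: "'a measure \<Rightarrow> ('a \<Rightarrow> real) \<Rightarrow> real \<Rightarrow> ennreal" where
  "tail_integral M f t =
     (\<integral>\<^sup>+u\<in>{t..}. emeasure (completion M) {x \<in> space M. f x > u} \<partial>lborel)"

end

theory Submission
  imports Defs
begin

text \<open>
  The covariance of \<open>Y\<close> minus that of \<open>W\<close> is
  \<open>2 powr (- K) * (s powr (2*H*K) + t powr (2*H*K) - (s powr (2*H) + t powr (2*H)) powr K)\<close>,
  which is positive semidefinite (the decomposition of Lei and Nualart). Hence at finitely many times
  \<open>Y\<close> has the law of \<open>W + \<eta>\<close> and of \<open>W - \<eta>\<close> for a centered Gaussian vector \<open>\<eta>\<close> independent of \<open>W\<close>,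
  and averaging over the two signs shows that every convex function of the vector has a larger
  expectation under \<open>Y\<close>. No Slepian-type interpolation is needed. This applies to
  a nondecreasing convex function of the maximum of the shifted values; monotone convergence along
  finite sets exhausting a countable dense set of times yields the supremum.
\<close>

text \<open>The factor \<open>2 powr ((1 - K) / 2)\<close> gives the terms
  \<open>\<bar>s - t\<bar> powr (2*H*K)\<close> of both covariances the coefficient
  \<open>2 powr (- K)\<close>, so they cancel and only a kernel in \<open>s powr (2*H)\<close> and
  \<open>t powr (2*H)\<close> remains. Two obstacles shape the proof. The processes live on
  different spaces and are Gaussian only through their linear combinations, so equality of joint
  laws must come from characteristic functions; one-dimensional Levy uniqueness is upgraded to
  vectors by trading exponentials for indicators, one coordinate at a time. Moreover, expectations
  may be infinite and \<open>g\<close> may be negative, while the midpoint argument and monotone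
  convergence work in \<open>ennreal\<close>; since both processes vanish almost surely at time 0,
  the supremum is at least \<open>m 0\<close>, and adding a constant repairs the sign. All
  conclusions come from one comparison for nondecreasing convex functions, with
  \<open>max y c\<close> and \<open>max (y - t) 0\<close> as instances; Fubini turns the latter into
  the tail integral.\<close>

subsection \<open>Uniqueness of joint laws from characteristic functions\<close>

text \<open>Normalizing the weights turns them into probability densities, to which Levy uniqueness
  applies. The weights are what makes an induction over coordinates possible: they carry the
  coordinates already treated.\<close>

lemma weighted_char_unique:
  fixes u :: "'a \<Rightarrow> real" and v :: "'b \<Rightarrow> real"
  assumes M: "prob_space M" and N: "prob_space N"
    and [measurable]: "u \<in> borel_measurable M" "v \<in> borel_measurable N"
      "X \<in> borel_measurable M" "Y \<in> borel_measurable N"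
    and u: "\<And>x. 0 \<le> u x" "\<And>x. u x \<le> b" and v: "\<And>x. 0 \<le> v x" "\<And>x. v x \<le> b"
    and eq: "\<And>t. (\<integral>x. of_real (u x) * iexp (t * X x) \<partial>M) = (\<integral>x. of_real (v x) * iexp (t * Y x) \<partial>N)"
    and [measurable]: "A \<in> sets borel"
  shows "(\<integral>x. u x * indicator A (X x) \<partial>M) = (\<integral>x. v x * indicator A (Y x) \<partial>N)"
proof -
  interpret M: prob_space M by fact
  interpret N: prob_space N by fact
  have iu: "integrable M u" and iv: "integrable N v"
    using u v by (auto intro!: M.integrable_const_bound[of _ b] N.integrable_const_bound[of _ b])
  define c where "c = (\<integral>x. u x \<partial>M)"
  \<comment> \<open>Frequency 0 shows that both weights have the same total mass, so one constant
    normalizes both.\<close>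
  have "complex_of_real c = complex_of_real (\<integral>x. v x \<partial>N)"
    using eq[of 0] by (simp add: c_def)
  then have c': "c = (\<integral>x. v x \<partial>N)" using of_real_eq_iff by blast
  show ?thesis
  proof (cases "c = 0")
    case True
    have "AE x in M. u x = 0"
      using True integral_nonneg_eq_0_iff_AE[OF iu] u by (simp add: c_def)
    then have "(\<integral>x. u x * indicator A (X x) \<partial>M) = (\<integral>x. 0 \<partial>M)"
      by (intro integral_cong_AE) auto
    moreover have "AE x in N. v x = 0"
      using True integral_nonneg_eq_0_iff_AE[OF iv] v by (simp add: c')
    then have "(\<integral>x. v x * indicator A (Y x) \<partial>N) = (\<integral>x. 0 \<partial>N)"
      by (intro integral_cong_AE) auto
    ultimately show ?thesis by simp
  next
    case False
    have "0 \<le> c" unfolding c_def using u by (intro Bochner_Integration.integral_nonneg) auto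
    with False have c: "0 < c" by simp
    define P where "P = density M (\<lambda>x. u x / c)"
    define Q where "Q = density N (\<lambda>x. v x / c)"
    have P: "prob_space P"
    proof
      show "emeasure P (space P) = 1"
        unfolding P_def using c u iu
        by (subst emeasure_density)
           (auto simp: nn_integral_eq_integral c_def[symmetric] cong: nn_integral_cong_simp
              intro!: trans[OF nn_integral_cong[of M _ "\<lambda>x. ennreal (u x / c)"]])
    qed
    have Q: "prob_space Q"
    proof
      show "emeasure Q (space Q) = 1"
        unfolding Q_def using c v iv
        by (subst emeasure_density)
           (auto simp: nn_integral_eq_integral c'[symmetric] cong: nn_integral_cong_simp
              intro!: trans[OF nn_integral_cong[of N _ "\<lambda>x. ennreal (v x / c)"]])
    qed
    have [measurable]: "X \<in> borel_measurable P" "Y \<in> borel_measurable Q"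
      by (simp_all add: P_def Q_def)
    have "distr P borel X = distr Q borel Y"
    proof (rule Levy_uniqueness)
      show "real_distribution (distr P borel X)" "real_distribution (distr Q borel Y)"
        by (auto intro!: real_distribution.intro prob_space.prob_space_distr P Q real_distribution_axioms.intro)
      show "char (distr P borel X) = char (distr Q borel Y)"
      proof
        fix t
        have "char (distr P borel X) t = (\<integral>x. (u x / c) *\<^sub>R iexp (t * X x) \<partial>M)"
          unfolding char_def P_def using u c
          by (subst integral_distr) (auto simp: integral_density)
        also have "\<dots> = (\<integral>x. of_real (u x) * iexp (t * X x) \<partial>M) / c"
          by (simp add: scaleR_conv_of_real)
        also have "\<dots> = (\<integral>x. of_real (v x) * iexp (t * Y x) \<partial>N) / c"
          by (simp only: eq)
        also have "\<dots> = (\<integral>x. (v x / c) *\<^sub>R iexp (t * Y x) \<partial>N)"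
          by (simp add: scaleR_conv_of_real)
        also have "\<dots> = char (distr Q borel Y) t"
          unfolding char_def Q_def using v c
          by (subst integral_distr) (auto simp: integral_density)
        finally show "char (distr P borel X) t = char (distr Q borel Y) t" .
      qed
    qed
    then have "(\<integral>y. indicator A y \<partial>distr P borel X) = (\<integral>y. indicator A y \<partial>distr Q borel Y :: real)"
      by (simp only:)
    then have "(\<integral>x. indicator A (X x) \<partial>P) = (\<integral>x. indicator A (Y x) \<partial>Q :: real)"
      by (subst (asm) (1 2) integral_distr) auto
    then have "(\<integral>x. (u x / c) *\<^sub>R indicator A (X x) \<partial>M) = (\<integral>x. (v x / c) *\<^sub>R indicator A (Y x) \<partial>N :: real)"
      unfolding P_def Q_def using u v c by (subst (asm) (1 2) integral_density) auto
    then show ?thesis using c by simp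
  qed
qed

text \<open>Each induction step replaces the exponential of one coordinate by the indicator of a
  Borel set, until only probabilities of boxes are left; these determine a law on a finite
  product.\<close>

lemma joint_char_unique:
  fixes X :: "'i \<Rightarrow> 'a \<Rightarrow> real" and Y :: "'i \<Rightarrow> 'b \<Rightarrow> real"
  assumes M: "prob_space M" and N: "prob_space N" and I: "finite I"
    and X [measurable]: "\<And>i. i \<in> I \<Longrightarrow> X i \<in> borel_measurable M"
    and Y [measurable]: "\<And>i. i \<in> I \<Longrightarrow> Y i \<in> borel_measurable N"
    and eq: "\<And>a. (\<integral>x. iexp (\<Sum>i\<in>I. a i * X i x) \<partial>M) = (\<integral>x. iexp (\<Sum>i\<in>I. a i * Y i x) \<partial>N)"
  shows "distr M (\<Pi>\<^sub>M i\<in>I. borel) (\<lambda>x. \<lambda>i\<in>I. X i x) = distr N (\<Pi>\<^sub>M i\<in>I. borel) (\<lambda>x. \<lambda>i\<in>I. Y i x)"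
proof -
  interpret M: prob_space M by fact
  interpret N: prob_space N by fact
  \<comment> \<open>\<open>J\<close> collects the coordinates already turned into indicators:
    \<open>J = {}\<close> is the hypothesis, \<open>J = I\<close> the box probabilities.\<close>
  have main: "(\<integral>x. of_real (\<Prod>j\<in>J. indicator (A j) (X j x)) * iexp (\<Sum>i\<in>I-J. a i * X i x) \<partial>M)
      = (\<integral>x. of_real (\<Prod>j\<in>J. indicator (A j) (Y j x)) * iexp (\<Sum>i\<in>I-J. a i * Y i x) \<partial>N)"
    if J: "J \<subseteq> I" and A: "\<And>j. j \<in> J \<Longrightarrow> A j \<in> sets borel" for J A a
  proof -
    have "finite J" using J I by (rule finite_subset)
    then show ?thesis using J A
    proof (induction J arbitrary: a rule: finite_induct)
      case empty
      then show ?case using eq by simp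
    next
      case (insert k J)
      define R where "R = I - insert k J"
      have k: "k \<in> I" "k \<notin> R" and IR: "I - J = insert k R" and finR: "finite R" and RI: "R \<subseteq> I"
        using insert I by (auto simp: R_def)
      have JI: "J \<subseteq> I" using insert by auto
      have [measurable]: "A k \<in> sets borel" using insert by auto
      have [measurable]: "X i \<in> borel_measurable M" "Y i \<in> borel_measurable N" if "i \<in> R" for i
        using that RI X Y by auto
      have [measurable]: "X i \<in> borel_measurable M" "Y i \<in> borel_measurable N" "A i \<in> sets borel"
        if "i \<in> J" for i using that JI X Y insert by auto
      have [measurable]: "X k \<in> borel_measurable M" "Y k \<in> borel_measurable N"
        using k X Y by auto
      define u where "u x = (\<Prod>j\<in>J. indicator (A j) (X j x) :: real)" for x
      define v where "v x = (\<Prod>j\<in>J. indicator (A j) (Y j x) :: real)" for x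
      have [measurable]: "u \<in> borel_measurable M" "v \<in> borel_measurable N"
        unfolding u_def[abs_def] v_def[abs_def] by measurable
      have u01: "0 \<le> u x" "u x \<le> 1" for x
        unfolding u_def by (auto intro!: prod_nonneg prod_le_1)
      have v01: "0 \<le> v x" "v x \<le> 1" for x
        unfolding v_def by (auto intro!: prod_nonneg prod_le_1)
      define p where "p x = (\<Sum>i\<in>R. a i * X i x)" for x
      define q where "q x = (\<Sum>i\<in>R. a i * Y i x)" for x
      have [measurable]: "p \<in> borel_measurable M" "q \<in> borel_measurable N"
        unfolding p_def[abs_def] q_def[abs_def] by measurable
      \<comment> \<open>The induction hypothesis is taken with coefficients \<open>s * a i\<close>
        on \<open>R\<close> and \<open>t\<close> at \<open>k\<close>. The scale \<open>s\<close>
        gives access to the phases 0, \<open>p\<close> and \<open>- p\<close>, from which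
        \<open>1 + cos p\<close> and \<open>1 + sin p\<close> are built.\<close>
      have E: "(\<integral>x. of_real (u x) * iexp (s * p x + t * X k x) \<partial>M)
          = (\<integral>x. of_real (v x) * iexp (s * q x + t * Y k x) \<partial>N)" for s t
      proof -
        have 1: "(\<Sum>i\<in>I - J. (if i = k then t else s * a i) * Z i) = s * (\<Sum>i\<in>R. a i * Z i) + t * Z k" for Z :: "'i \<Rightarrow> real"
        proof -
          have "(\<Sum>i\<in>R. (if i = k then t else s * a i) * Z i) = (\<Sum>i\<in>R. s * (a i * Z i))"
            using k by (intro sum.cong) auto
          then show ?thesis unfolding IR using k finR by (simp add: sum_distrib_left)
        qed
        show ?thesis
          using insert.IH[OF JI, of "\<lambda>i. if i = k then t else s * a i"] insert.prems(2)
          unfolding 1 u_def v_def p_def q_def by auto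
      qed
      have bnd: "integrable M (\<lambda>x. of_real (u x) * iexp (f x))" if [measurable]: "f \<in> borel_measurable M" for f
        using u01 by (intro M.integrable_const_bound[of _ 1]) (auto simp: norm_mult)
      have bnd': "integrable N (\<lambda>x. of_real (v x) * iexp (f x))" if [measurable]: "f \<in> borel_measurable N" for f
        using v01 by (intro N.integrable_const_bound[of _ 1]) (auto simp: norm_mult)
      \<comment> \<open>The remaining phase factor is complex; it is handled through the nonnegative weights
        \<open>1 + cos\<close> and \<open>1 + sin\<close>, to which uniqueness for real measures applies.\<close>
      have W: "(\<integral>x. (u x * (1 + h (p x))) * indicator (A k) (X k x) \<partial>M)
             = (\<integral>x. (v x * (1 + h (q x))) * indicator (A k) (Y k x) \<partial>N)"
        if h[measurable]: "h \<in> borel_measurable borel" and h1: "\<And>r. \<bar>h r\<bar> \<le> 1"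
          and hc: "\<And>r. of_real (h r) = w * iexp r + z * iexp (- r)" for h w z
      proof (rule weighted_char_unique[where b=2, OF M N])
        show "0 \<le> u x * (1 + h (p x))" for x using u01[of x] h1[of "p x"] by (intro mult_nonneg_nonneg) auto
        show "0 \<le> v x * (1 + h (q x))" for x using v01[of x] h1[of "q x"] by (intro mult_nonneg_nonneg) auto
        show "u x * (1 + h (p x)) \<le> 2" for x using mult_mono[of "u x" 1 "1 + h (p x)" 2] u01[of x] h1[of "p x"] by auto
        show "v x * (1 + h (q x)) \<le> 2" for x using mult_mono[of "v x" 1 "1 + h (q x)" 2] v01[of x] h1[of "q x"] by auto
        fix t
        have expand: "of_real (r * (1 + h s)) * iexp y =
            of_real r * iexp (0 * s + y) + w * (of_real r * iexp (1 * s + y)) + z * (of_real r * iexp ((-1) * s + y))" for r s y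
          by (simp add: hc ring_distribs exp_add exp_diff exp_minus divide_inverse)
        show "(\<integral>x. of_real (u x * (1 + h (p x))) * iexp (t * X k x) \<partial>M) =
              (\<integral>x. of_real (v x * (1 + h (q x))) * iexp (t * Y k x) \<partial>N)"
          unfolding expand
          by (subst (1 2) Bochner_Integration.integral_add,
              (intro Bochner_Integration.integrable_add integrable_mult_right bnd bnd'; measurable)+)
             (subst (1 2) Bochner_Integration.integral_add,
              (intro Bochner_Integration.integrable_add integrable_mult_right bnd bnd'; measurable)+,
              simp only: integral_mult_right_zero E)
      qed measurable
      \<comment> \<open>The choice \<open>h = 0\<close> isolates the constant 1; subtracting it in
        \<open>W'\<close> leaves the signed weight \<open>h\<close> itself.\<close>
      have U0: "(\<integral>x. u x * indicator (A k) (X k x) \<partial>M) = (\<integral>x. v x * indicator (A k) (Y k x) \<partial>N)"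
        using W[of "\<lambda>_. 0" 0 0] by simp
      have iM: "integrable M (\<lambda>x. u x * h (p x) * indicator (A k) (X k x))"
        if [measurable]: "h \<in> borel_measurable borel" and "\<And>r. \<bar>h r\<bar> \<le> 1" for h
        using u01 that(2) by (intro M.integrable_const_bound[of _ 1])
          (auto simp: abs_mult intro!: mult_le_one split: split_indicator)
      have iN: "integrable N (\<lambda>x. v x * h (q x) * indicator (A k) (Y k x))"
        if [measurable]: "h \<in> borel_measurable borel" and "\<And>r. \<bar>h r\<bar> \<le> 1" for h
        using v01 that(2) by (intro N.integrable_const_bound[of _ 1])
          (auto simp: abs_mult intro!: mult_le_one split: split_indicator)
      have W': "(\<integral>x. u x * h (p x) * indicator (A k) (X k x) \<partial>M)
             = (\<integral>x. v x * h (q x) * indicator (A k) (Y k x) \<partial>N)"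
        if h: "h \<in> borel_measurable borel" "\<And>r. \<bar>h r\<bar> \<le> 1"
          and hc: "\<And>r. of_real (h r) = w * iexp r + z * iexp (- r)" for h w z
        using W[OF that] U0 iM[of "\<lambda>_. 1"] iN[of "\<lambda>_. 1"] iM[OF h] iN[OF h]
        by (simp add: ring_distribs)
      have C: "(\<integral>x. u x * cos (p x) * indicator (A k) (X k x) \<partial>M)
             = (\<integral>x. v x * cos (q x) * indicator (A k) (Y k x) \<partial>N)"
        by (rule W'[of cos "1/2" "1/2"]) (auto simp: cos_of_real[symmetric] cos_exp_eq field_simps)
      have S: "(\<integral>x. u x * sin (p x) * indicator (A k) (X k x) \<partial>M)
             = (\<integral>x. v x * sin (q x) * indicator (A k) (Y k x) \<partial>N)"
        by (rule W'[of sin "1/(2*\<i>)" "-1/(2*\<i>)"]) (auto simp: sin_of_real[symmetric] sin_exp_eq field_simps)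
      have split: "of_real (\<Prod>j\<in>insert k J. indicator (A j) (Z j)) * iexp (\<Sum>i\<in>R. a i * Z i) =
         of_real ((\<Prod>j\<in>J. indicator (A j) (Z j)) * cos (\<Sum>i\<in>R. a i * Z i) * indicator (A k) (Z k))
         + \<i> * of_real ((\<Prod>j\<in>J. indicator (A j) (Z j)) * sin (\<Sum>i\<in>R. a i * Z i) * indicator (A k) (Z k))" for Z
        using insert(1,2) by (simp add: exp_Euler cos_of_real[symmetric] sin_of_real[symmetric] ring_distribs mult_ac)
      show ?case
        unfolding R_def[symmetric] split unfolding u_def[symmetric] v_def[symmetric] p_def[symmetric] q_def[symmetric]
        by (subst (1 2) Bochner_Integration.integral_add,
            (intro integrable_mult_right integrable_of_real iM[of cos] iM[of sin] iN[of cos] iN[of sin]; simp)+)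
           (simp only: integral_mult_right_zero integral_complex_of_real C S)
    qed
  qed
  have [measurable]: "(\<lambda>x. \<lambda>i\<in>I. X i x) \<in> M \<rightarrow>\<^sub>M (\<Pi>\<^sub>M i\<in>I. borel)" "(\<lambda>x. \<lambda>i\<in>I. Y i x) \<in> N \<rightarrow>\<^sub>M (\<Pi>\<^sub>M i\<in>I. borel)"
    by measurable
  interpret MP: prob_space "distr M (\<Pi>\<^sub>M i\<in>I. borel) (\<lambda>x. \<lambda>i\<in>I. X i x)" by (rule M.prob_space_distr) measurable
  show ?thesis
  proof (rule measure_eqI_PiM_finite[OF I])
    fix A :: "'i \<Rightarrow> real set" assume A: "\<And>i. i \<in> I \<Longrightarrow> A i \<in> sets borel"
    then have PA: "Pi\<^sub>E I A \<in> sets (\<Pi>\<^sub>M i\<in>I. borel)" using I by (auto intro: sets_PiM_I_finite)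
    have "complex_of_real (measure M ((\<lambda>x. \<lambda>i\<in>I. X i x) -` Pi\<^sub>E I A \<inter> space M))
        = complex_of_real (measure N ((\<lambda>x. \<lambda>i\<in>I. Y i x) -` Pi\<^sub>E I A \<inter> space N))"
    proof -
      have i1: "indicator ((\<lambda>x. \<lambda>i\<in>I. Z i x) -` Pi\<^sub>E I A \<inter> \<Omega>) x = (\<Prod>j\<in>I. indicator (A j) (Z j x) :: real)"
        if "x \<in> \<Omega>" for Z x and \<Omega> :: "'z set"
        using that I by (auto simp: indicator_def PiE_iff prod_zero_iff intro!: prod.neutral[symmetric])
      have "measure M ((\<lambda>x. \<lambda>i\<in>I. X i x) -` Pi\<^sub>E I A \<inter> space M) = (\<integral>x. (\<Prod>j\<in>I. indicator (A j) (X j x)) \<partial>M)"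
        by (subst Bochner_Integration.integral_cong[OF refl i1[symmetric]]) (auto simp: Int_assoc)
      moreover have "measure N ((\<lambda>x. \<lambda>i\<in>I. Y i x) -` Pi\<^sub>E I A \<inter> space N) = (\<integral>x. (\<Prod>j\<in>I. indicator (A j) (Y j x)) \<partial>N)"
        by (subst Bochner_Integration.integral_cong[OF refl i1[symmetric]]) (auto simp: Int_assoc)
      ultimately show ?thesis using main[of I A] A by (simp del: of_real_prod)
    qed
    then show "distr M (\<Pi>\<^sub>M i\<in>I. borel) (\<lambda>x. \<lambda>i\<in>I. X i x) (Pi\<^sub>E I A) = distr N (\<Pi>\<^sub>M i\<in>I. borel) (\<lambda>x. \<lambda>i\<in>I. Y i x) (Pi\<^sub>E I A)"
      using PA by (simp add: emeasure_distr M.emeasure_eq_measure N.emeasure_eq_measure)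
  next
    show "range (\<lambda>_::nat. Pi\<^sub>E I (\<lambda>_. UNIV)) \<subseteq> prod_algebra I (\<lambda>_. borel :: real measure)"
      using I by (auto intro!: prod_algebraI_finite)
  qed (auto simp: space_PiM)
qed

subsection \<open>Characteristic functions of Gaussian processes\<close>

text \<open>A Bochner integral is 0 for a non-integrable function, so the prescribed means and
  covariances alone guarantee no moments; Gaussianity has to supply them.\<close>

lemma gaussian_rv_square_integrable:
  assumes "prob_space M" "gaussian_rv M X"
  shows "integrable M X" "integrable M (\<lambda>x. (X x)\<^sup>2)"
proof -
  interpret prob_space M by fact
  have [measurable]: "X \<in> borel_measurable M"
    using assms by (simp add: gaussian_rv_def)
  consider (const) \<mu> where "AE x in M. X x = \<mu>"
    | (normal) \<mu> \<sigma> where "0 < \<sigma>" "distributed M lborel X (normal_density \<mu> \<sigma>)"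
    using assms by (auto simp: gaussian_rv_def)
  then have "integrable M X \<and> integrable M (\<lambda>x. (X x)\<^sup>2)"
  proof cases
    case const
    then have "AE x in M. norm (X x) \<le> \<bar>\<mu>\<bar>" "AE x in M. norm ((X x)\<^sup>2) \<le> \<mu>\<^sup>2"
      by (eventually_elim, simp)+
    then show ?thesis
      by (intro conjI integrable_const_bound[of X "\<bar>\<mu>\<bar>"] integrable_const_bound[of "\<lambda>x. (X x)\<^sup>2" "\<mu>\<^sup>2"]) simp_all
  next
    case normal
    have 1: "integrable lborel (\<lambda>x. normal_density \<mu> \<sigma> x * x)"
      using normal(1) by (rule integrable_normal_moment_nz_1)
    have "integrable lborel (\<lambda>x. normal_density \<mu> \<sigma> x * (x - \<mu>)^2
        + 2 * \<mu> * (normal_density \<mu> \<sigma> x * x) - \<mu>\<^sup>2 * normal_density \<mu> \<sigma> x)"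
      using normal(1) by (intro Bochner_Integration.integrable_add Bochner_Integration.integrable_diff
          integrable_mult_right 1 integrable_normal_moment integrable_normal_density)
    then have 2: "integrable lborel (\<lambda>x. normal_density \<mu> \<sigma> x * x\<^sup>2)"
      by (simp add: power2_eq_square algebra_simps)
    show ?thesis
      using distributed_integrable[OF normal(2), of "\<lambda>x. x"] distributed_integrable[OF normal(2), of "\<lambda>x. x\<^sup>2"] 1 2
      by simp
  qed
  then show "integrable M X" "integrable M (\<lambda>x. (X x)\<^sup>2)" by auto
qed

text \<open>Frequency 1 is enough: in linear combinations of a process the coefficients absorb every
  other frequency.\<close>

lemma gaussian_rv_char:
  assumes "prob_space M" "gaussian_rv M X" and mean: "(\<integral>x. X x \<partial>M) = 0"
  shows "(\<integral>x. iexp (X x) \<partial>M) = exp (- (\<integral>x. (X x)\<^sup>2 \<partial>M) / 2)"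
proof -
  interpret prob_space M by fact
  have [measurable]: "X \<in> borel_measurable M"
    using assms by (simp add: gaussian_rv_def)
  consider (const) \<mu> where "AE x in M. X x = \<mu>"
    | (normal) \<mu> \<sigma> where "0 < \<sigma>" "distributed M lborel X (normal_density \<mu> \<sigma>)"
    using assms by (auto simp: gaussian_rv_def)
  then show ?thesis
  proof cases
    case const
    then have "(\<integral>x. X x \<partial>M) = (\<integral>x. \<mu> \<partial>M)" by (intro integral_cong_AE) auto
    with mean have "\<mu> = 0" by (simp add: prob_space)
    with const have ae: "AE x in M. X x = 0" by simp
    then have "(\<integral>x. (X x)\<^sup>2 \<partial>M) = (\<integral>x. 0 \<partial>M)" by (intro integral_cong_AE) auto
    moreover have "(\<integral>x. iexp (X x) \<partial>M) = (\<integral>x. 1 \<partial>M)"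
      using ae by (intro integral_cong_AE) auto
    ultimately show ?thesis by (simp add: prob_space)
  next
    case normal
    have "\<mu> = 0" using normal_distributed_expectation[OF normal] mean by simp
    note D = normal(2)[unfolded this]
    have var: "(\<integral>x. (X x)\<^sup>2 \<partial>M) = \<sigma>\<^sup>2"
      using normal_distributed_variance[OF normal(1) D] mean by simp
    have "distributed M lborel (\<lambda>x. 0 + (1/\<sigma>) * X x) (normal_density (0 + (1/\<sigma>) * 0) (\<bar>1/\<sigma>\<bar> * \<sigma>))"
      using normal(1) D by (intro normal_density_affine) auto
    then have S: "distributed M lborel (\<lambda>x. X x / \<sigma>) std_normal_density"
      using normal(1) by simp
    have "distr M borel (\<lambda>x. X x / \<sigma>) = distr M lborel (\<lambda>x. X x / \<sigma>)"
      by (rule distr_cong) auto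
    also have "\<dots> = std_normal_distribution"
      using S by (simp add: distributed_def)
    finally have "char (distr M borel (\<lambda>x. X x / \<sigma>)) \<sigma> = char std_normal_distribution \<sigma>"
      by simp
    then have "(\<integral>x. iexp (\<sigma> * (X x / \<sigma>)) \<partial>M) = exp (- (\<sigma>\<^sup>2) / 2)"
      unfolding char_std_normal_distribution unfolding char_def
      by (subst (asm) integral_distr) auto
    then show ?thesis using normal(1) var by simp
  qed
qed

lemma centered_gaussian_process_linear:
  assumes "centered_gaussian_process M I C Z" "finite F" "F \<subseteq> I"
  shows "gaussian_rv M (\<lambda>x. \<Sum>t\<in>F. a t * Z t x)"
  using assms by (simp add: centered_gaussian_process_def gaussian_process_def)

lemma centered_gaussian_process_rv:
  assumes "centered_gaussian_process M I C Z" "t \<in> I"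
  shows "gaussian_rv M (Z t)"
  using centered_gaussian_process_linear[OF assms(1), of "{t}" "\<lambda>_. 1"] assms(2) by simp

lemma centered_gaussian_process_char:
  assumes Z: "centered_gaussian_process M I C Z" and F: "finite F" "F \<subseteq> I"
  shows "(\<integral>x. iexp (\<Sum>t\<in>F. a t * Z t x) \<partial>M) = exp (- (\<Sum>s\<in>F. \<Sum>t\<in>F. a s * a t * C s t) / 2)"
proof -
  interpret prob_space M using Z by (simp add: centered_gaussian_process_def gaussian_process_def)
  note gt = centered_gaussian_process_rv[OF Z]
  note sq = gaussian_rv_square_integrable[OF prob_space_axioms gt]
  have [measurable]: "Z t \<in> borel_measurable M" if "t \<in> I" for t
    using gt[OF that] by (simp add: gaussian_rv_def)
  have mean: "(\<integral>x. Z t x \<partial>M) = 0" if "t \<in> I" for t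
    using Z that by (simp add: centered_gaussian_process_def)
  have cov: "(\<integral>x. Z s x * Z t x \<partial>M) = C s t" if "s \<in> I" "t \<in> I" for s t
    
  proof -
    have "covariance M (Z s) (Z t) = C s t"
      using Z that by (simp add: centered_gaussian_process_def)
    then show ?thesis using mean that by (simp add: covariance_def)
  qed
  \<comment> \<open>Integrability of the products is what allows the variance of the linear
    combination to be expanded term by term.\<close>
  have prod: "integrable M (\<lambda>x. Z s x * Z t x)" if "s \<in> I" "t \<in> I" for s t
  proof (rule Bochner_Integration.integrable_bound)
    show "integrable M (\<lambda>x. (Z s x)\<^sup>2 + (Z t x)\<^sup>2)" using sq that by simp
    have "\<bar>Z s x * Z t x\<bar> \<le> (Z s x)\<^sup>2 + (Z t x)\<^sup>2" for x
      using sum_squares_bound[of "\<bar>Z s x\<bar>" "\<bar>Z t x\<bar>"]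
        mult_nonneg_nonneg[OF abs_ge_zero[of "Z s x"] abs_ge_zero[of "Z t x"]]
      unfolding abs_mult power2_abs by linarith
    then show "AE x in M. norm (Z s x * Z t x) \<le> norm ((Z s x)\<^sup>2 + (Z t x)\<^sup>2)" by simp
  qed (use that in simp)
  have "(\<integral>x. (\<Sum>t\<in>F. a t * Z t x) \<partial>M) = 0"
    using F sq(1) mean by (subst Bochner_Integration.integral_sum) (auto intro!: sum.neutral)
  moreover have "(\<integral>x. (\<Sum>t\<in>F. a t * Z t x)\<^sup>2 \<partial>M) = (\<integral>x. (\<Sum>s\<in>F. \<Sum>t\<in>F. a s * a t * (Z s x * Z t x)) \<partial>M)"
    by (simp add: power2_eq_square sum_product mult_ac)
  moreover have "\<dots> = (\<Sum>s\<in>F. \<Sum>t\<in>F. a s * a t * C s t)"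
    using F prod cov by (subst Bochner_Integration.integral_sum)
      (auto intro!: Bochner_Integration.integrable_sum sum.cong simp: Bochner_Integration.integral_sum subset_eq)
  ultimately show ?thesis
    using gaussian_rv_char[OF prob_space_axioms centered_gaussian_process_linear[OF Z F]] by simp
qed

text \<open>Serves two purposes: with factor 1 it restricts the index set to \<open>{0..T}\<close>,
  and it passes from \<open>B\<close> to \<open>Y\<close>, which is prescribed on
  \<open>{0..T}\<close> only.\<close>

lemma centered_gaussian_process_scale:
  assumes Z: "centered_gaussian_process M I C Z" and J: "J \<subseteq> I"
    and Y: "\<And>t x. t \<in> J \<Longrightarrow> Y t x = \<kappa> * Z t x"
  shows "centered_gaussian_process M J (\<lambda>s t. \<kappa>\<^sup>2 * C s t) Y"
  unfolding centered_gaussian_process_def gaussian_process_def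
proof (intro conjI allI impI ballI)
  show "prob_space M" using Z by (simp add: centered_gaussian_process_def gaussian_process_def)
  fix F a assume F: "finite F \<and> F \<subseteq> J"
  have "(\<lambda>x. \<Sum>t\<in>F. a t * Y t x) = (\<lambda>x. \<Sum>t\<in>F. (a t * \<kappa>) * Z t x)"
    using F Y by (intro ext sum.cong refl) (simp add: subset_iff mult.assoc)
  moreover have "gaussian_rv M (\<lambda>x. \<Sum>t\<in>F. (a t * \<kappa>) * Z t x)"
    using F J by (intro centered_gaussian_process_linear[OF Z]) auto
  ultimately show "gaussian_rv M (\<lambda>x. \<Sum>t\<in>F. a t * Y t x)" by simp
next
  have YZ: "Y t = (\<lambda>x. \<kappa> * Z t x)" if "t \<in> J" for t by (intro ext Y that)
  fix t assume t: "t \<in> J"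
  then show "(\<integral>x. Y t x \<partial>M) = 0"
    using Z J by (auto simp: YZ centered_gaussian_process_def)
  fix s assume s: "s \<in> J"
  have "covariance M (Z s) (Z t) = C s t" using Z J s t by (auto simp: centered_gaussian_process_def)
  moreover have "covariance M (Y s) (Y t) = \<kappa>\<^sup>2 * covariance M (Z s) (Z t)"
  proof -
    have "(\<kappa> * z - \<kappa> * u) * (\<kappa> * z' - \<kappa> * u') = \<kappa>\<^sup>2 * ((z - u) * (z' - u'))" for z u z' u'
      by (simp add: power2_eq_square algebra_simps)
    then show ?thesis by (simp add: YZ s t covariance_def)
  qed
  ultimately show "covariance M (Y s) (Y t) = \<kappa>\<^sup>2 * C s t" by simp
qed

text \<open>Meant for time 0, where both covariances vanish; it yields the almost sure lower bound
  for the supremum.\<close>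

lemma centered_gaussian_process_zero_variance:
  assumes Z: "centered_gaussian_process M I C Z" and t: "t \<in> I" "C t t = 0"
  shows "AE x in M. Z t x = 0"
proof -
  have M: "prob_space M" using Z by (simp add: centered_gaussian_process_def gaussian_process_def)
  have sq: "integrable M (\<lambda>x. (Z t x)\<^sup>2)"
    using gaussian_rv_square_integrable(2)[OF M centered_gaussian_process_rv[OF Z t(1)]] .
  have "(\<integral>x. Z t x \<partial>M) = 0" "covariance M (Z t) (Z t) = 0"
    using Z t by (auto simp: centered_gaussian_process_def)
  then have "(\<integral>x. (Z t x)\<^sup>2 \<partial>M) = 0" by (simp add: covariance_def power2_eq_square)
  then show ?thesis using integral_nonneg_eq_0_iff_AE[OF sq] by simp
qed

subsection \<open>Positive semidefinite kernels\<close>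

text \<open>Since \<^term>\<open>x powr K\<close> is a multiple of the integral of
  \<^term>\<open>(1 - exp (- \<theta> * x)) * \<theta> powr (- 1 - K)\<close> over \<^term>\<open>\<theta> > 0\<close>, the kernel is a mixture of the
  rank-one kernels \<^term>\<open>(1 - exp (- \<theta> * x)) * (1 - exp (- \<theta> * y))\<close>.\<close>

lemma powr_kernel_psd:
  fixes K :: real and x :: "'i \<Rightarrow> real"
  assumes K: "0 < K" "K \<le> 1" and x: "\<And>i. i \<in> F \<Longrightarrow> 0 \<le> x i"
  shows "0 \<le> (\<Sum>i\<in>F. \<Sum>j\<in>F. a i * a j * (x i powr K + x j powr K - (x i + x j) powr K))"
proof (cases "K = 1")
  \<comment> \<open>The integral representation breaks down at \<open>K = 1\<close>, its integrand
    behaving like 1/\<theta> near 0, but then the kernel is identically 0.\<close>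
  case True
  have "(\<Sum>i\<in>F. \<Sum>j\<in>F. a i * a j * (x i powr K + x j powr K - (x i + x j) powr K)) = (\<Sum>i\<in>F. \<Sum>j\<in>F. 0)"
    using x True by (intro sum.cong refl) (simp add: powr_one)
  then show ?thesis by simp
next
  case False
  with K have K1: "K < 1" by simp
  define \<phi> where "\<phi> r \<theta> = (1 - exp (- \<theta> * r)) * \<theta> powr (- 1 - K) * indicator {0<..} \<theta>" for r \<theta> :: real
  have [measurable]: "\<phi> r \<in> borel_measurable borel" for r
    unfolding \<phi>_def[abs_def] by measurable
  have \<phi>_nonneg: "0 \<le> \<phi> r \<theta>" if "0 \<le> r" for r \<theta>
    unfolding \<phi>_def using that by (auto simp: indicator_def intro!: mult_nonneg_nonneg)
  have int1: "integrable lborel (\<phi> 1)"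
  proof (rule Bochner_Integration.integrable_bound)
    have lb: "integrable lborel (\<lambda>\<theta>. indicator S \<theta> * \<theta> powr e)"
      if "(\<lambda>\<theta>. \<theta> powr e) integrable_on S" "S \<in> sets borel" for S :: "real set" and e
    proof -
      have "set_integrable lebesgue S (\<lambda>\<theta>. \<theta> powr e)"
        using that(1) by (rule nonnegative_absolutely_integrable_1) simp
      then show ?thesis
        using that(2) by (simp add: set_integrable_def integrable_completion)
    qed
    have "integrable lborel (\<lambda>\<theta>. indicator {0..1} \<theta> * \<theta> powr (- K))"
      using K1 by (intro lb integrable_on_powr_from_0) auto
    moreover have "integrable lborel (\<lambda>\<theta>. indicator {1..} \<theta> * \<theta> powr (- 1 - K))"
      using K has_integral_powr_to_inf[of "- 1 - K" 1] by (intro lb) (auto simp: integrable_on_def)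
    ultimately show "integrable lborel (\<lambda>\<theta>. indicator {0..1} \<theta> * \<theta> powr (- K) + indicator {1..} \<theta> * \<theta> powr (- 1 - K))"
      by simp
    \<comment> \<open>Near 0 the factor \<open>1 - exp (- \<theta>) \<le> \<theta>\<close> cancels
      one power, and \<open>K < 1\<close> makes the rest integrable; at infinity
      \<open>0 < K\<close> suffices.\<close>
    have "\<bar>\<phi> 1 \<theta>\<bar> \<le> \<bar>indicator {0..1} \<theta> * \<theta> powr (- K) + indicator {1..} \<theta> * \<theta> powr (- 1 - K)\<bar>" for \<theta>
    proof -
      consider "\<theta> \<le> 0" | "0 < \<theta>" "\<theta> < 1" | "1 \<le> \<theta>" by linarith
      then show ?thesis
      proof cases
        case 2
        have "1 - exp (- \<theta>) \<le> \<theta>" using exp_ge_add_one_self[of "- \<theta>"] by simp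
        then have "(1 - exp (- \<theta>)) * \<theta> powr (- 1 - K) \<le> \<theta> * \<theta> powr (- 1 - K)"
          by (intro mult_right_mono) auto
        also have "\<dots> = \<theta> powr (- K)" using 2 powr_add[of \<theta> 1 "- 1 - K"] by simp
        finally show ?thesis using 2 \<phi>_nonneg[of 1 \<theta>] by (simp add: \<phi>_def)
      next
        case 3
        have "(1 - exp (- \<theta>)) * \<theta> powr (- 1 - K) \<le> 1 * \<theta> powr (- 1 - K)"
          by (intro mult_right_mono) auto
        then show ?thesis using 3 \<phi>_nonneg[of 1 \<theta>] by (simp add: \<phi>_def add_increasing)
      qed (simp add: \<phi>_def)
    qed
    then show "AE \<theta> in lborel. norm (\<phi> 1 \<theta>) \<le> norm (indicator {0..1} \<theta> * \<theta> powr (- K) + indicator {1..} \<theta> * \<theta> powr (- 1 - K))"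
      by simp
  qed simp
  define c where "c = (\<integral>\<theta>. \<phi> 1 \<theta> \<partial>lborel)"
  \<comment> \<open>Substituting \<open>r * \<theta>\<close> for \<theta> produces
    \<open>r powr (1 + K)\<close> from the weight and \<open>1 / r\<close> from the measure, hence
    \<open>r powr K\<close>.\<close>
  have scale: "has_bochner_integral lborel (\<phi> r) (c * r powr K)" if r: "0 \<le> r" for r
  proof (cases "r = 0")
    case False
    with r have r: "0 < r" by simp
    have eq: "\<phi> r \<theta> = r powr (1 + K) * \<phi> 1 (0 + r * \<theta>)" for \<theta>
      using r by (auto simp: \<phi>_def indicator_def powr_mult zero_less_mult_iff mult_ac powr_add[symmetric]) 
    have i: "has_bochner_integral lborel (\<phi> 1) c"
      using int1 unfolding c_def by (rule has_bochner_integral_integrable)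
    have "has_bochner_integral lborel (\<lambda>\<theta>. \<phi> 1 (0 + r * \<theta>)) (c /\<^sub>R \<bar>r\<bar>)"
      using lborel_has_bochner_integral_real_affine_iff[of r "\<phi> 1" c 0] r i by simp
    then have "has_bochner_integral lborel (\<lambda>\<theta>. r powr (1 + K) * \<phi> 1 (0 + r * \<theta>)) (r powr (1 + K) * (c /\<^sub>R \<bar>r\<bar>))"
      by (rule has_bochner_integral_mult_right)
    moreover have "r powr (1 + K) * (c /\<^sub>R \<bar>r\<bar>) = c * r powr K"
      using r by (simp add: powr_add field_simps)
    ultimately show ?thesis by (simp only: eq[abs_def])
  qed (use K in \<open>simp add: \<phi>_def[abs_def] has_bochner_integral_zero\<close>)
  \<comment> \<open>The value of \<open>c\<close> is irrelevant; its sign allows dividing it out at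
    the end. It cannot vanish because \<open>\<phi> 1\<close> is positive on
    \<open>{0<..1}\<close>.\<close>
  have c: "0 < c"
  proof -
    have "0 \<le> c" unfolding c_def using \<phi>_nonneg by (intro Bochner_Integration.integral_nonneg) auto
    moreover have "c \<noteq> 0"
    proof
      assume "c = 0"
      then have "AE \<theta> in lborel. \<phi> 1 \<theta> = 0"
        using integral_nonneg_eq_0_iff_AE[OF int1] \<phi>_nonneg by (simp add: c_def)
      then have "AE \<theta> in lborel. \<theta> \<notin> {0<..(1::real)}"
        by eventually_elim (auto simp: \<phi>_def indicator_def)
      then have "emeasure lborel {0<..(1::real)} = 0"
        by (subst AE_iff_measurable[symmetric, where P="\<lambda>\<theta>. \<theta> \<notin> {0<..1}"]) auto
      then show False by simp
    qed
    ultimately show ?thesis by simp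
  qed
  have "has_bochner_integral lborel (\<lambda>\<theta>. \<Sum>i\<in>F. \<Sum>j\<in>F. a i * a j * (\<phi> (x i) \<theta> + \<phi> (x j) \<theta> - \<phi> (x i + x j) \<theta>))
      (\<Sum>i\<in>F. \<Sum>j\<in>F. a i * a j * (c * x i powr K + c * x j powr K - c * (x i + x j) powr K))"
    using x by (intro has_bochner_integral_sum has_bochner_integral_mult_right
        has_bochner_integral_add has_bochner_integral_diff scale) auto
  moreover have "(\<Sum>i\<in>F. \<Sum>j\<in>F. a i * a j * (\<phi> (x i) \<theta> + \<phi> (x j) \<theta> - \<phi> (x i + x j) \<theta>))
      = (\<Sum>i\<in>F. a i * (1 - exp (- \<theta> * x i)))\<^sup>2 * (\<theta> powr (- 1 - K) * indicator {0<..} \<theta>)" for \<theta>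
    unfolding power2_eq_square sum_product unfolding sum_distrib_right \<phi>_def
    by (intro sum.cong refl) (simp add: exp_diff exp_minus divide_inverse algebra_simps)
  ultimately have "has_bochner_integral lborel (\<lambda>\<theta>. (\<Sum>i\<in>F. a i * (1 - exp (- \<theta> * x i)))\<^sup>2 * (\<theta> powr (- 1 - K) * indicator {0<..} \<theta>))
      (\<Sum>i\<in>F. \<Sum>j\<in>F. a i * a j * (c * x i powr K + c * x j powr K - c * (x i + x j) powr K))"
    by simp
  then have "0 \<le> (\<Sum>i\<in>F. \<Sum>j\<in>F. a i * a j * (c * x i powr K + c * x j powr K - c * (x i + x j) powr K))"
    by (subst has_bochner_integral_integral_eq[symmetric]) (auto intro!: Bochner_Integration.integral_nonneg)
  also have "\<dots> = c * (\<Sum>i\<in>F. \<Sum>j\<in>F. a i * a j * (x i powr K + x j powr K - (x i + x j) powr K))"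
    by (simp add: sum_distrib_left algebra_simps)
  finally show ?thesis using c by (simp add: zero_le_mult_iff)
qed

text \<open>Cholesky elimination: the pivot \<open>p\<close> contributes the vector
  \<open>w\<close>, and the Schur complement \<open>A i j - w i * w j\<close> is again positive
  semidefinite on the remaining indices. The vectors are indexed by \<open>F\<close> itself, so one
  standard normal per index will generate the Gaussian vector.\<close>

lemma psd_factorization:
  fixes A :: "'i \<Rightarrow> 'i \<Rightarrow> real"
  assumes "finite F" and "\<And>i j. A i j = A j i"
    and "\<And>a. 0 \<le> (\<Sum>i\<in>F. \<Sum>j\<in>F. a i * a j * A i j)"
  shows "\<exists>v. \<forall>i\<in>F. \<forall>j\<in>F. A i j = (\<Sum>k\<in>F. v k i * v k j)"
  using assms
proof (induction F arbitrary: A rule: finite_induct)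
  case (insert p F)
  have sym: "A i j = A j i" for i j by fact
  have expand: "(\<Sum>i\<in>insert p F. \<Sum>j\<in>insert p F. a i * a j * A i j)
      = (a p)\<^sup>2 * A p p + 2 * a p * (\<Sum>j\<in>F. a j * A p j) + (\<Sum>i\<in>F. \<Sum>j\<in>F. a i * a j * A i j)" for a
  proof -
    have "(\<Sum>i\<in>F. a i * a p * A i p) = a p * (\<Sum>j\<in>F. a j * A p j)"
      "(\<Sum>i\<in>F. a p * a i * A p i) = a p * (\<Sum>j\<in>F. a j * A p j)"
      by (simp_all add: sum_distrib_left sym[of p] mult_ac)
    then show ?thesis using insert(1,2)
      by (simp add: sum.distrib power2_eq_square)
  qed
  note pos = insert.prems(2)[unfolded expand]
  have App: "0 \<le> A p p"
  proof -
    have "(\<Sum>j\<in>F. (if j = p then 1 else 0) * A p j) = 0"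
      "(\<Sum>i\<in>F. \<Sum>j\<in>F. (if i = p then 1 else 0) * (if j = p then 1 else 0) * A i j) = 0"
      using insert(2) by (auto intro!: sum.neutral)
    then show ?thesis using pos[of "\<lambda>i. if i = p then 1 else 0"] by simp
  qed
  \<comment> \<open>A zero pivot forces a zero row: otherwise the test vector with \<open>s\<close>
    at \<open>p\<close> and 1 at \<open>j\<close> would give the form the value -1, which is how
    \<open>s\<close> is chosen.\<close>
  have zero: "A p j = 0" if "A p p = 0" "j \<in> F" for j
  proof (rule ccontr)
    assume nz: "A p j \<noteq> 0"
    define s where "s = - (A j j + 1) / (2 * A p j)"
    define a where "a i = (if i = p then s else if i = j then 1 else 0)" for i
    have "j \<noteq> p" using that insert(2) by auto
    have 1: "a i = (if i = j then 1 else 0)" if "i \<in> F" for i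
      using that insert(2) by (auto simp: a_def)
    have "(\<Sum>i\<in>F. a i * A p i) = A p j"
      using that insert(1) by (simp add: 1 if_distrib[of "\<lambda>z. z * _"] cong: if_cong)
    moreover have "(\<Sum>k\<in>F. a i * a k * A i k) = (if i = j then A j j else 0)" if "i \<in> F" for i
      using that \<open>j \<in> F\<close> insert(1) by (simp add: 1 if_distrib[of "\<lambda>z. z * _"] cong: if_cong)
    then have "(\<Sum>i\<in>F. \<Sum>k\<in>F. a i * a k * A i k) = A j j"
      using that insert(1) by simp
    ultimately have "0 \<le> 2 * s * A p j + A j j"
      using pos[of a] that by (simp add: a_def)
    then show False using nz by (simp add: s_def field_simps)
  qed
  define w where "w i = (if A p p = 0 then 0 else A p i / sqrt (A p p))" for i
  have w: "w p * w j = A p j" if "j \<in> insert p F" for j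
    using zero[of j] that App by (auto simp: w_def)
  have "0 \<le> (\<Sum>i\<in>F. \<Sum>j\<in>F. a i * a j * (A i j - w i * w j))" for a
  proof -
    define S where "S = (\<Sum>j\<in>F. a j * w j)"
    \<comment> \<open>Completing the square: this value at \<open>p\<close> makes the square vanish
      and leaves the form of the Schur complement. If \<open>w p = 0\<close>, division by zero
      yields 0, which is right because then all of \<open>w\<close>, and so \<open>S\<close>, is
      0.\<close>
    define b where "b i = (if i = p then - S / w p else a i)" for i
    have b: "b i = a i" if "i \<in> F" for i using that insert(2) by (auto simp: b_def)
    have "(\<Sum>j\<in>F. b j * A p j) = w p * S"
      unfolding S_def sum_distrib_left using w by (intro sum.cong) (auto simp: b)
    moreover have "(\<Sum>i\<in>F. \<Sum>j\<in>F. b i * b j * A i j) = (\<Sum>i\<in>F. \<Sum>j\<in>F. a i * a j * A i j)"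
      by (intro sum.cong) (auto simp: b)
    ultimately have "0 \<le> (b p * w p + S)\<^sup>2 - S\<^sup>2 + (\<Sum>i\<in>F. \<Sum>j\<in>F. a i * a j * A i j)"
      using pos[of b] w[of p] by (simp add: power2_eq_square algebra_simps)
    moreover have "b p * w p + S = 0"
    proof (cases "w p = 0")
      case True
      then have "w i = 0" for i using App by (auto simp: w_def split: if_splits)
      then show ?thesis by (simp add: S_def)
    qed (simp add: b_def)
    moreover have "S\<^sup>2 = (\<Sum>i\<in>F. \<Sum>j\<in>F. a i * a j * (w i * w j))"
      unfolding S_def power2_eq_square sum_product by (intro sum.cong) auto
    ultimately show ?thesis by (simp add: right_diff_distrib sum_subtractf)
  qed
  then obtain v where v: "\<forall>i\<in>F. \<forall>j\<in>F. A i j - w i * w j = (\<Sum>k\<in>F. v k i * v k j)"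
    using insert.IH[of "\<lambda>i j. A i j - w i * w j"] sym by (auto simp: mult.commute)
  have A: "A i j = w i * w j + (\<Sum>k\<in>F. v k i * v k j)" if "i \<in> F" "j \<in> F" for i j
    using v that by (metis add.commute diff_add_cancel)
  define v' where "v' k i = (if k = p then w i else if i = p then 0 else v k i)" for k i
  have "A i j = (\<Sum>k\<in>insert p F. v' k i * v' k j)" if "i \<in> insert p F" "j \<in> insert p F" for i j
  proof -
    have "(\<Sum>k\<in>F. v' k i * v' k j) = (if i = p \<or> j = p then 0 else \<Sum>k\<in>F. v k i * v k j)"
      using insert(2) by (auto simp: v'_def intro!: sum.cong sum.neutral)
    then show ?thesis
      using insert(1,2) A w[of i] w[of j] that sym[of i p] by (auto simp: v'_def mult.commute)
  qed
  then show ?case by blast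
qed simp

subsection \<open>Convex comparison of Gaussian vectors\<close>

lemma std_normal_sum_char:
  fixes b :: "'k \<Rightarrow> real"
  assumes "finite F"
  shows "(\<integral>\<xi>. iexp (\<Sum>k\<in>F. b k * \<xi> k) \<partial>(\<Pi>\<^sub>M k\<in>F. std_normal_distribution)) = exp (- (\<Sum>k\<in>F. (b k)\<^sup>2) / 2)"
proof -
  interpret std: real_distribution std_normal_distribution by (rule real_dist_normal_dist)
  interpret product_sigma_finite "\<lambda>_::'k. std_normal_distribution" ..
  have "(\<integral>\<xi>. iexp (\<Sum>k\<in>F. b k * \<xi> k) \<partial>(\<Pi>\<^sub>M k\<in>F. std_normal_distribution))
      = (\<integral>\<xi>. (\<Prod>k\<in>F. iexp (b k * \<xi> k)) \<partial>(\<Pi>\<^sub>M k\<in>F. std_normal_distribution))"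
    using assms by (simp add: exp_sum sum_distrib_left)
  also have "\<dots> = (\<Prod>k\<in>F. \<integral>r. iexp (b k * r) \<partial>std_normal_distribution)"
    using assms by (intro product_integral_prod std.integrable_const_bound[of _ 1]) (auto simp del: of_real_mult)
  also have "\<dots> = (\<Prod>k\<in>F. exp (of_real (- ((b k)\<^sup>2) / 2)))"
    using fun_cong[OF char_std_normal_distribution]
    unfolding char_def exp_of_real by simp
  also have "\<dots> = exp (- (\<Sum>k\<in>F. (b k)\<^sup>2) / 2)"
    using assms by (simp add: exp_sum[symmetric] exp_of_real[symmetric] sum_divide_distrib sum_negf)
  finally show ?thesis .
qed

text \<open>The hypotheses are characteristic functions rather than Gaussian processes, because this
  is all that is needed to identify the law of \<open>X\<close> plus or minus the noise with that of
  \<open>Y\<close>. Values in \<open>ennreal\<close> let both sides be infinite.\<close>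

lemma gaussian_convex_comparison:
  fixes X :: "'i \<Rightarrow> 'a \<Rightarrow> real" and Y :: "'i \<Rightarrow> 'b \<Rightarrow> real"
  assumes M: "prob_space M" and N: "prob_space N" and F: "finite F"
    and X [measurable]: "\<And>i. i \<in> F \<Longrightarrow> X i \<in> borel_measurable M"
    and Y [measurable]: "\<And>i. i \<in> F \<Longrightarrow> Y i \<in> borel_measurable N"
    and charX: "\<And>a. (\<integral>x. iexp (\<Sum>i\<in>F. a i * X i x) \<partial>M) = exp (- (\<Sum>i\<in>F. \<Sum>j\<in>F. a i * a j * C i j) / 2)"
    and charY: "\<And>a. (\<integral>x. iexp (\<Sum>i\<in>F. a i * Y i x) \<partial>N) = exp (- (\<Sum>i\<in>F. \<Sum>j\<in>F. a i * a j * D i j) / 2)"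
    and sym: "\<And>i j. D i j - C i j = D j i - C j i"
    and psd: "\<And>a. 0 \<le> (\<Sum>i\<in>F. \<Sum>j\<in>F. a i * a j * (D i j - C i j))"
    and f [measurable]: "f \<in> borel_measurable (\<Pi>\<^sub>M i\<in>F. borel)"
    and convex: "\<And>w z. 2 * f (\<lambda>i\<in>F. w i) \<le> f (\<lambda>i\<in>F. w i + z i) + f (\<lambda>i\<in>F. w i - z i :: real)"
  shows "(\<integral>\<^sup>+x. f (\<lambda>i\<in>F. X i x) \<partial>M) \<le> (\<integral>\<^sup>+x. f (\<lambda>i\<in>F. Y i x) \<partial>N)"
proof -
  obtain v where v: "\<And>i j. i \<in> F \<Longrightarrow> j \<in> F \<Longrightarrow> D i j - C i j = (\<Sum>k\<in>F. v k i * v k j)"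
    using psd_factorization[of F "\<lambda>i j. D i j - C i j", OF F sym psd] by blast
  interpret M: prob_space M by fact
  interpret N: prob_space N by fact
  interpret std: real_distribution std_normal_distribution by (rule real_dist_normal_dist)
  define G where "G = (\<Pi>\<^sub>M k\<in>F. std_normal_distribution)"
  have sets_G [measurable_cong]: "sets G = sets (\<Pi>\<^sub>M k\<in>F. borel)"
    unfolding G_def by (intro sets_PiM_cong) auto
  interpret G: prob_space G unfolding G_def by (rule prob_space_PiM) (rule std.prob_space_axioms)
  interpret P: pair_prob_space M G ..
  \<comment> \<open>The coordinates of \<xi> are independent standard normals, so \<eta> has
    covariance \<open>D i j - C i j\<close>; the product space makes it independent of
    \<open>X\<close>.\<close>
  define \<eta> where "\<eta> i \<xi> = (\<Sum>k\<in>F. \<xi> k * v k i)" for i \<xi>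
  have \<eta> [measurable]: "\<eta> i \<in> borel_measurable G" for i
    unfolding \<eta>_def[abs_def] by measurable
  define Z where "Z s i y = X i (fst y) + s * \<eta> i (snd y)" for s :: real and i and y :: "'a \<times> ('i \<Rightarrow> real)"
  have Z [measurable]: "Z s i \<in> borel_measurable (M \<Otimes>\<^sub>M G)" if "i \<in> F" for s i
    using that unfolding Z_def[abs_def] by measurable
  \<comment> \<open>The sign \<open>s\<close> enters the covariance of \<open>s * \<eta> i\<close>
    only through its square, so both signs are treated at once.\<close>
  have charZ: "(\<integral>y. iexp (\<Sum>i\<in>F. a i * Z s i y) \<partial>(M \<Otimes>\<^sub>M G)) = (\<integral>x. iexp (\<Sum>i\<in>F. a i * Y i x) \<partial>N)"
    if s: "s\<^sup>2 = 1" for s a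
  proof -
    define b where "b k = s * (\<Sum>i\<in>F. a i * v k i)" for k
    have lin: "(\<Sum>i\<in>F. a i * Z s i (x, \<xi>)) = (\<Sum>i\<in>F. a i * X i x) + (\<Sum>k\<in>F. b k * \<xi> k)" for x \<xi>
    proof -
      have "(\<Sum>i\<in>F. a i * (s * \<eta> i \<xi>)) = (\<Sum>k\<in>F. b k * \<xi> k)"
        unfolding \<eta>_def b_def sum_distrib_left sum_distrib_right
        by (subst sum.swap) (simp add: mult_ac)
      then show ?thesis by (simp add: Z_def ring_distribs sum.distrib)
    qed
    have bsq: "(\<Sum>k\<in>F. (b k)\<^sup>2) = (\<Sum>i\<in>F. \<Sum>j\<in>F. a i * a j * (D i j - C i j))"
    proof -
      have "(\<Sum>k\<in>F. (b k)\<^sup>2) = (\<Sum>k\<in>F. \<Sum>i\<in>F. \<Sum>j\<in>F. a i * a j * (v k i * v k j))"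
        unfolding b_def power_mult_distrib s
        by (simp add: power2_eq_square sum_product mult_ac)
      also have "\<dots> = (\<Sum>i\<in>F. \<Sum>k\<in>F. \<Sum>j\<in>F. a i * a j * (v k i * v k j))"
        by (rule sum.swap)
      also have "\<dots> = (\<Sum>i\<in>F. \<Sum>j\<in>F. \<Sum>k\<in>F. a i * a j * (v k i * v k j))"
        by (intro sum.cong refl sum.swap)
      also have "\<dots> = (\<Sum>i\<in>F. \<Sum>j\<in>F. a i * a j * (D i j - C i j))"
        by (intro sum.cong refl) (simp add: v sum_distrib_left)
      finally show ?thesis .
    qed
    have "(\<integral>y. iexp (\<Sum>i\<in>F. a i * Z s i y) \<partial>(M \<Otimes>\<^sub>M G))
        = (\<integral>x. \<integral>\<xi>. iexp (\<Sum>i\<in>F. a i * Z s i (x, \<xi>)) \<partial>G \<partial>M)"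
      by (intro P.integral_fst'[symmetric] P.integrable_const_bound[of _ 1]) (auto simp del: of_real_sum)
    also have "\<dots> = (\<integral>x. \<integral>\<xi>. iexp (\<Sum>i\<in>F. a i * X i x) * iexp (\<Sum>k\<in>F. b k * \<xi> k) \<partial>G \<partial>M)"
      unfolding lin of_real_add ring_distribs exp_add ..
    also have "\<dots> = (\<integral>x. iexp (\<Sum>i\<in>F. a i * X i x) \<partial>M) * (\<integral>\<xi>. iexp (\<Sum>k\<in>F. b k * \<xi> k) \<partial>G)"
      by (simp only: integral_mult_right_zero integral_mult_left_zero)
    also have "\<dots> = of_real (exp (- (\<Sum>i\<in>F. \<Sum>j\<in>F. a i * a j * C i j) / 2) * exp (- (\<Sum>k\<in>F. (b k)\<^sup>2) / 2))"
      unfolding charX G_def std_normal_sum_char[OF F] by simp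
    also have "\<dots> = of_real (exp (- (\<Sum>i\<in>F. \<Sum>j\<in>F. a i * a j * D i j) / 2))"
      unfolding bsq exp_add[symmetric] by (simp add: right_diff_distrib sum_subtractf diff_divide_distrib)
    finally show ?thesis using charY by simp
  qed
  have law: "(\<integral>\<^sup>+y. f (\<lambda>i\<in>F. Z s i y) \<partial>(M \<Otimes>\<^sub>M G)) = (\<integral>\<^sup>+x. f (\<lambda>i\<in>F. Y i x) \<partial>N)" if "s\<^sup>2 = 1" for s
  proof -
    have eq: "distr (M \<Otimes>\<^sub>M G) (\<Pi>\<^sub>M i\<in>F. borel) (\<lambda>y. \<lambda>i\<in>F. Z s i y) = distr N (\<Pi>\<^sub>M i\<in>F. borel) (\<lambda>x. \<lambda>i\<in>F. Y i x)"
      by (rule joint_char_unique[OF P.prob_space_axioms N F Z Y charZ[OF that]])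
    have "(\<integral>\<^sup>+y. f (\<lambda>i\<in>F. Z s i y) \<partial>(M \<Otimes>\<^sub>M G)) = (\<integral>\<^sup>+w. f w \<partial>distr (M \<Otimes>\<^sub>M G) (\<Pi>\<^sub>M i\<in>F. borel) (\<lambda>y. \<lambda>i\<in>F. Z s i y))"
      by (subst nn_integral_distr) measurable
    also have "\<dots> = (\<integral>\<^sup>+x. f (\<lambda>i\<in>F. Y i x) \<partial>N)"
      unfolding eq by (subst nn_integral_distr) measurable
    finally show ?thesis .
  qed
  \<comment> \<open>\<open>X + \<eta>\<close> and \<open>X - \<eta>\<close> both have the law of \<open>Y\<close>, so midpoint convexity replaces
    the conditional Jensen inequality and no integrability is needed.\<close>
  have "2 * (\<integral>\<^sup>+x. f (\<lambda>i\<in>F. X i x) \<partial>M) = (\<integral>\<^sup>+x. \<integral>\<^sup>+\<xi>. 2 * f (\<lambda>i\<in>F. X i x) \<partial>G \<partial>M)"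
    by (simp add: nn_integral_cmult G.emeasure_space_1)
  also have "\<dots> = (\<integral>\<^sup>+y. 2 * f (\<lambda>i\<in>F. X i (fst y)) \<partial>(M \<Otimes>\<^sub>M G))"
    by (subst G.nn_integral_fst[symmetric]) simp_all
  also have "\<dots> \<le> (\<integral>\<^sup>+y. f (\<lambda>i\<in>F. Z 1 i y) + f (\<lambda>i\<in>F. Z (-1) i y) \<partial>(M \<Otimes>\<^sub>M G))"
    unfolding Z_def using convex by (intro nn_integral_mono) simp
  also have "\<dots> = 2 * (\<integral>\<^sup>+x. f (\<lambda>i\<in>F. Y i x) \<partial>N)"
    by (subst nn_integral_add) (simp_all add: law mult_2)
  finally show ?thesis
    by (simp add: ennreal_mult_le_mult_iff)
qed

lemma convex_on_max:
  fixes f g :: "'a::real_vector \<Rightarrow> real"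
  assumes f: "convex_on S f" and g: "convex_on S g"
  shows "convex_on S (\<lambda>x. max (f x) (g x))"
proof (rule convex_onI)
  show "convex S" using f by (rule convex_on_imp_convex)
  fix t :: real and x y assume t: "0 < t" "t < 1" and xy: "x \<in> S" "y \<in> S"
  have "(1 - t) * f x + t * f y \<le> (1 - t) * max (f x) (g x) + t * max (f y) (g y)"
    "(1 - t) * g x + t * g y \<le> (1 - t) * max (f x) (g x) + t * max (f y) (g y)"
    using t by (auto intro!: add_mono mult_left_mono)
  moreover have "f ((1 - t) *\<^sub>R x + t *\<^sub>R y) \<le> (1 - t) * f x + t * f y"
    "g ((1 - t) *\<^sub>R x + t *\<^sub>R y) \<le> (1 - t) * g x + t * g y"
    using convex_onD[OF f, of t x y] convex_onD[OF g, of t x y] t xy by auto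
  ultimately show "max (f ((1 - t) *\<^sub>R x + t *\<^sub>R y)) (g ((1 - t) *\<^sub>R x + t *\<^sub>R y))
      \<le> (1 - t) * max (f x) (g x) + t * max (f y) (g y)"
    by simp
qed

text \<open>Each coordinate of \<open>w\<close> is the average of those of \<open>w + z\<close> and
  \<open>w - z\<close>, so its shifted maximum is at most the average of the two maxima.
  Monotonicity carries this through \<open>h\<close>, and convexity then splits the average.\<close>

lemma gaussian_max_comparison:
  fixes X :: "'i \<Rightarrow> 'a \<Rightarrow> real" and Y :: "'i \<Rightarrow> 'b \<Rightarrow> real" and h :: "real \<Rightarrow> real"
  assumes X: "centered_gaussian_process M I C X" and Y: "centered_gaussian_process N I D Y"
    and F: "finite F" "F \<noteq> {}" "F \<subseteq> I"
    and sym: "\<And>s t. D s t - C s t = D t s - C t s"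
    and psd: "\<And>a. 0 \<le> (\<Sum>s\<in>F. \<Sum>t\<in>F. a s * a t * (D s t - C s t))"
    and h: "mono h" "convex_on UNIV h" "\<And>y. 0 \<le> h y"
  shows "(\<integral>\<^sup>+x. ennreal (h (Max ((\<lambda>t. X t x + m t) ` F))) \<partial>M)
       \<le> (\<integral>\<^sup>+x. ennreal (h (Max ((\<lambda>t. Y t x + m t) ` F))) \<partial>N)"
proof -
  have meas: "Z t \<in> borel_measurable P" if "centered_gaussian_process P I R Z" "t \<in> F" for P :: "'z measure" and R Z t
    using centered_gaussian_process_rv[OF that(1)] that(2) F(3) by (auto simp: gaussian_rv_def)
  have [measurable]: "h \<in> borel_measurable borel" using h(1) by (rule borel_measurable_mono)
  define f where "f z = ennreal (h (Max ((\<lambda>t. z t + m t) ` F)))" for z :: "'i \<Rightarrow> real"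
  have f [measurable]: "f \<in> borel_measurable (\<Pi>\<^sub>M i\<in>F. borel)"
    unfolding f_def[abs_def] using F(1) by measurable
  have fr: "f (\<lambda>t\<in>F. z t) = ennreal (h (Max ((\<lambda>t. z t + m t) ` F)))" for z
    unfolding f_def by (intro arg_cong[where f="\<lambda>A. ennreal (h (Max A))"] image_cong) auto
  have "(\<integral>\<^sup>+x. f (\<lambda>t\<in>F. X t x) \<partial>M) \<le> (\<integral>\<^sup>+x. f (\<lambda>t\<in>F. Y t x) \<partial>N)"
  proof (rule gaussian_convex_comparison[OF _ _ F(1) meas[OF X] meas[OF Y]
        centered_gaussian_process_char[OF X F(1,3)] centered_gaussian_process_char[OF Y F(1,3)] sym psd f])
    show "prob_space M" "prob_space N" using X Y by (auto simp: centered_gaussian_process_def gaussian_process_def)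
    fix w z :: "'i \<Rightarrow> real"
    let ?p = "Max ((\<lambda>t. (w t + z t) + m t) ` F)" and ?q = "Max ((\<lambda>t. (w t - z t) + m t) ` F)"
    have "w t + m t \<le> (?p + ?q) / 2" if "t \<in> F" for t
    proof -
      have "(w t + z t) + m t \<le> ?p" "(w t - z t) + m t \<le> ?q" using that F(1) by auto
      then show ?thesis by (simp add: field_simps)
    qed
    then have "Max ((\<lambda>t. w t + m t) ` F) \<le> (?p + ?q) / 2"
      using F(1,2) by (intro Max.boundedI) auto
    then have "h (Max ((\<lambda>t. w t + m t) ` F)) \<le> h ((?p + ?q) / 2)" by (rule monoD[OF h(1)])
    also have "\<dots> \<le> (h ?p + h ?q) / 2"
      using convex_onD[OF h(2), of "1/2" ?p ?q] by (simp add: field_simps)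
    finally have "2 * h (Max ((\<lambda>t. w t + m t) ` F)) \<le> h ?p + h ?q" by simp
    then have "ennreal (2 * h (Max ((\<lambda>t. w t + m t) ` F))) \<le> ennreal (h ?p + h ?q)" by (rule ennreal_leI)
    then show "2 * f (\<lambda>t\<in>F. w t) \<le> f (\<lambda>t\<in>F. w t + z t) + f (\<lambda>t\<in>F. w t - z t)"
      unfolding fr using h(3) by (simp add: ennreal_mult)
  qed
  then show ?thesis unfolding fr .
qed

subsection \<open>Suprema of continuous paths\<close>

text \<open>By compactness the supremum is attained; continuity puts a nearly optimal point into
  some \<open>D n\<close>, and it stays in all later sets.\<close>

lemma SUP_dense_tendsto:
  fixes p :: "real \<Rightarrow> real"
  assumes p: "continuous_on {0..T} p" and T: "0 \<le> T"
    and D: "\<And>n. finite (D n)" "\<And>n. D n \<noteq> {}" "\<And>n. D n \<subseteq> {0..T}" "incseq D"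
    and dense: "{0..T} \<subseteq> closure (\<Union>n. D n)"
  shows "(\<lambda>n. Max (p ` D n)) \<longlonglongrightarrow> (SUP t\<in>{0..T}. p t)"
proof -
  obtain t where t: "t \<in> {0..T}" "\<And>s. s \<in> {0..T} \<Longrightarrow> p s \<le> p t"
    using continuous_attains_sup[of "{0..T}" p] p T by auto
  have "(SUP t\<in>{0..T}. p t) = p t"
    using t by (intro cSup_eq_maximum) auto
  moreover have "(\<lambda>n. Max (p ` D n)) \<longlonglongrightarrow> p t"
  proof (rule LIMSEQ_I)
    fix e :: real assume "0 < e"
    then obtain \<delta> where \<delta>: "0 < \<delta>" "\<And>s. s \<in> {0..T} \<Longrightarrow> dist s t < \<delta> \<Longrightarrow> dist (p s) (p t) < e"
      using p t(1) unfolding continuous_on_iff by metis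
    obtain s n where s: "s \<in> D n" "dist s t < \<delta>"
    proof -
      have "t \<in> closure (\<Union>n. D n)" using dense t(1) by auto
      then show thesis using that \<delta>(1) unfolding closure_approachable by auto
    qed
    have "norm (Max (p ` D k) - p t) < e" if "n \<le> k" for k
    proof -
      have "s \<in> D k" using s(1) incseqD[OF D(4) that] by auto
      then have "p s \<le> Max (p ` D k)" using D(1) by simp
      moreover have "Max (p ` D k) \<le> p t" using D(1,2) D(3)[of k] t(2) by (intro Max.boundedI) auto
      moreover have "\<bar>p s - p t\<bar> < e" using \<delta>(2)[of s] s D(3)[of n] by (auto simp: dist_real_def)
      ultimately show ?thesis by simp
    qed
    then show "\<exists>n. \<forall>k\<ge>n. norm (Max (p ` D k) - p t) < e" by blast
  qed
  ultimately show ?thesis by simp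
qed

lemma dense_finite_subsets:
  fixes T :: real
  assumes "0 \<le> T"
  obtains D :: "nat \<Rightarrow> real set" where "\<And>n. finite (D n)" "\<And>n. 0 \<in> D n" "\<And>n. D n \<subseteq> {0..T}" "incseq D"
    "{0..T} \<subseteq> closure (\<Union>n. D n)"
proof -
  obtain S where S: "countable S" "S \<subseteq> {0..T}" "{0..T} \<subseteq> closure S"
    by (rule separable)
  \<comment> \<open>Inserting 0 keeps every set nonempty, so that \<open>Max\<close> is
    meaningful.\<close>
  define D where "D n = insert 0 (from_nat_into S ` {..n})" for n
  have "S \<noteq> {}" using S(3) assms by auto
  then have r: "range (from_nat_into S) = S" using S(1) by (rule range_from_nat_into)
  have "S \<subseteq> (\<Union>n. D n)"
    by (subst r[symmetric]) (auto simp: D_def)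
  then have "{0..T} \<subseteq> closure (\<Union>n. D n)"
    using S(3) closure_mono by blast
  moreover have "D n \<subseteq> {0..T}" for n unfolding D_def using r S(2) assms by auto
  moreover have "incseq D" unfolding D_def incseq_def by auto
  ultimately show ?thesis by (intro that[of D]) (auto simp: D_def)
qed

lemma borel_measurable_completion_AE:
  fixes f f' :: "'a \<Rightarrow> real"
  assumes f' [measurable]: "f' \<in> borel_measurable M" and ae: "AE x in M. f x = f' x"
  shows "f \<in> borel_measurable (completion M)"
proof (rule measurableI)
  fix S :: "real set" assume [measurable]: "S \<in> sets borel"
  show "f -` S \<inter> space (completion M) \<in> sets (completion M)"
  proof (rule completion.in_sets_AE)
    show "f' -` S \<inter> space M \<in> sets (completion M)" by (rule sets_completionI_sets) measurable
    show "AE x in completion M. (x \<in> f' -` S \<inter> space M) = (x \<in> f -` S \<inter> space (completion M))"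
      using AE_completion[OF ae] AE_space by eventually_elim auto
  qed simp
qed simp

text \<open>The lower bound makes the negative part integrable, which excludes \<infinity> -
  \<infinity>, and reduces the extended expectation to a nonnegative integral open to monotone
  convergence.\<close>

lemma ext_expectation_shift:
  assumes M: "prob_space M" and [measurable]: "f \<in> borel_measurable (completion M)"
    and b: "0 \<le> b" and lower: "AE x in M. - b \<le> f x"
  shows "has_expectation M f"
    and "ext_expectation M f = enn2ereal (\<integral>\<^sup>+x. ennreal (f x + b) \<partial>M) - ereal b"
proof -
  interpret M: prob_space M by fact
  have ae: "AE x in completion M. - b \<le> f x" using lower by (rule AE_completion)
  define P where "P = (\<integral>\<^sup>+x. ennreal (f x) \<partial>completion M)"
  define Q where "Q = (\<integral>\<^sup>+x. ennreal (- f x) \<partial>completion M)"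
  define A where "A = (\<integral>\<^sup>+x. ennreal (f x + b) \<partial>completion M)"
  have "Q \<le> (\<integral>\<^sup>+x. ennreal b \<partial>completion M)"
    unfolding Q_def using ae by (intro nn_integral_mono_AE) (auto intro!: ennreal_leI)
  then have Q: "Q \<le> ennreal b" by (simp add: M.emeasure_space_1)
  then have Qfin: "Q < \<infinity>" using le_less_trans ennreal_less_top by (metis infinity_ennreal_def)
  \<comment> \<open>Pointwise, positive part plus \<open>b\<close> equals \<open>f + b\<close> plus
    negative part. In this additive form nothing is subtracted in \<open>ennreal\<close>; the finite
    \<open>Q\<close> is moved across only afterwards.\<close>
  have sum: "P + ennreal b = A + Q"
  proof -
    have "P + ennreal b = (\<integral>\<^sup>+x. ennreal (f x) + ennreal b \<partial>completion M)"
      unfolding P_def by (subst nn_integral_add) (auto simp: M.emeasure_space_1)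
    also have "\<dots> = (\<integral>\<^sup>+x. ennreal (f x + b) + ennreal (- f x) \<partial>completion M)"
    proof (rule nn_integral_cong_AE, use ae in eventually_elim)
      fix x assume "- b \<le> f x"
      then show "ennreal (f x) + ennreal b = ennreal (f x + b) + ennreal (- f x)"
        using b by (cases "0 \<le> f x") (auto simp: ennreal_neg ennreal_plus[symmetric] simp del: ennreal_plus)
    qed
    also have "\<dots> = A + Q"
      unfolding A_def Q_def by (subst nn_integral_add) auto
    finally show ?thesis .
  qed
  show "has_expectation M f"
    using Qfin by (simp add: has_expectation_def Q_def)
  have "enn2ereal P - enn2ereal Q = enn2ereal A - ereal b"
    using sum Qfin b
    by (cases P rule: ennreal_cases; cases Q rule: ennreal_cases; cases A rule: ennreal_cases)
       (auto simp: ennreal_plus[symmetric] enn2ereal_ennreal simp del: ennreal_plus)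
  then show "ext_expectation M f = enn2ereal (\<integral>\<^sup>+x. ennreal (f x + b) \<partial>M) - ereal b"
    unfolding ext_expectation_def P_def Q_def A_def by (simp add: nn_integral_completion)
qed

text \<open>Layer cake formula: Fubini on the region \<open>t \<le> u < f x\<close>, whose section
  at \<open>x\<close> has length \<open>f x - t\<close>, truncated at 0.\<close>

lemma tail_integral_eq:
  assumes M: "prob_space M" and f: "f \<in> borel_measurable (completion M)"
  shows "tail_integral M f t = (\<integral>\<^sup>+x. ennreal (f x - t) \<partial>completion M)"
proof -
  interpret C: prob_space "completion M" using M by (rule prob_space.prob_space_completion)
  interpret pair_sigma_finite "completion M" lborel ..
  note f [measurable]
  have "tail_integral M f t
      = (\<integral>\<^sup>+u. \<integral>\<^sup>+x. indicator {t..} u * indicator {u<..} (f x) \<partial>completion M \<partial>lborel)"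
    unfolding tail_integral_def
  proof (intro nn_integral_cong)
    fix u
    have "(\<integral>\<^sup>+x. indicator {u<..} (f x) \<partial>completion M) = emeasure (completion M) {x \<in> space M. f x > u}"
    proof -
      have "{x \<in> space M. f x > u} \<in> sets (completion M)"
        using measurable_sets[OF f, of "{u<..}"] by (simp add: vimage_def Int_def conj_commute)
      then have "emeasure (completion M) {x \<in> space M. f x > u} = (\<integral>\<^sup>+x. indicator {x \<in> space M. f x > u} x \<partial>completion M)"
        by (rule nn_integral_indicator[symmetric])
      also have "\<dots> = (\<integral>\<^sup>+x. indicator {u<..} (f x) \<partial>completion M)"
        by (intro nn_integral_cong) (auto simp: indicator_def)
      finally show ?thesis by simp
    qed
    then show "emeasure (completion M) {x \<in> space M. f x > u} * indicator {t..} u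
        = (\<integral>\<^sup>+x. indicator {t..} u * indicator {u<..} (f x) \<partial>completion M)"
      by (subst nn_integral_cmult) (auto simp: mult.commute)
  qed
  also have "\<dots> = (\<integral>\<^sup>+x. \<integral>\<^sup>+u. indicator {t..} u * indicator {u<..} (f x) \<partial>lborel \<partial>completion M)"
  proof (rule Fubini')
    have "(\<lambda>(x, u). indicator {z. t \<le> snd z \<and> snd z < f (fst z)} (x, u) :: ennreal) \<in> borel_measurable (completion M \<Otimes>\<^sub>M lborel)"
      by measurable
    then show "(\<lambda>(x, u). indicator {t..} u * indicator {u<..} (f x) :: ennreal) \<in> borel_measurable (completion M \<Otimes>\<^sub>M lborel)"
      by (rule measurable_cong[THEN iffD1, rotated]) (auto simp: indicator_def)
  qed
  also have "\<dots> = (\<integral>\<^sup>+x. ennreal (f x - t) \<partial>completion M)"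
  proof (intro nn_integral_cong)
    fix x
    have "(\<integral>\<^sup>+u. indicator {t..} u * indicator {u<..} (f x) \<partial>lborel) = (\<integral>\<^sup>+u. indicator {t..<f x} u \<partial>lborel)"
      by (intro nn_integral_cong) (auto simp: indicator_def)
    also have "\<dots> = ennreal (f x - t)"
      by (cases "t \<le> f x") (auto simp: ennreal_neg)
    finally show "(\<integral>\<^sup>+u. indicator {t..} u * indicator {u<..} (f x) \<partial>lborel) = ennreal (f x - t)" .
  qed
  finally show ?thesis .
qed

text \<open>Continuity of \<open>h\<close> transfers the convergence of the finite maxima, and
  monotonicity makes it increasing. Measurability in the completion comes from the almost sure
  equality with a limit of measurable functions.\<close>

lemma path_sup_monotone_limit:
  fixes h :: "real \<Rightarrow> real"
  assumes T: "0 \<le> T" and D: "\<And>n. finite (D n)" "\<And>n. 0 \<in> D n" "\<And>n. D n \<subseteq> {0..T}" "incseq D"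
      "{0..T} \<subseteq> closure (\<Union>n. D n)"
    and Z: "\<And>t. t \<in> {0..T} \<Longrightarrow> Z t \<in> borel_measurable M"
    and cont: "AE x in M. continuous_on {0..T} (\<lambda>t. Z t x)"
    and h: "mono h" "continuous_on UNIV h"
  shows "(\<lambda>x. h (path_sup T Z x)) \<in> borel_measurable (completion M)"
    and "(\<integral>\<^sup>+x. ennreal (h (path_sup T Z x)) \<partial>M) = (SUP n. \<integral>\<^sup>+x. ennreal (h (Max ((\<lambda>t. Z t x) ` D n))) \<partial>M)"
proof -
  have ne: "D n \<noteq> {}" for n using D(2)[of n] by auto
  have [measurable]: "Z t \<in> borel_measurable M" if "t \<in> D n" for t n
    using that D(3)[of n] Z by auto
  have [measurable]: "h \<in> borel_measurable borel" using h(1) by (rule borel_measurable_mono)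
  define G where "G n x = h (Max ((\<lambda>t. Z t x) ` D n))" for n x
  have [measurable]: "G n \<in> borel_measurable M" for n
    unfolding G_def[abs_def] using D(1)[of n] by measurable
  have inc: "G n x \<le> G (Suc n) x" for n x
    unfolding G_def using D(1) ne incseq_SucD[OF D(4), of n] by (intro monoD[OF h(1)] Max_mono) auto
  have lim: "AE x in M. (\<lambda>n. G n x) \<longlonglongrightarrow> h (path_sup T Z x)"
    using cont
  proof eventually_elim
    case (elim x)
    have "(\<lambda>n. Max ((\<lambda>t. Z t x) ` D n)) \<longlonglongrightarrow> path_sup T Z x"
      unfolding path_sup_def by (rule SUP_dense_tendsto[OF elim T D(1) ne D(3-5)])
    then show ?case
      unfolding G_def using h(2) by (auto simp: continuous_on_eq_continuous_at intro: isCont_tendsto_compose)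
  qed
  have "AE x in M. h (path_sup T Z x) = lim (\<lambda>n. G n x)"
    using lim by eventually_elim (rule limI[symmetric])
  then show "(\<lambda>x. h (path_sup T Z x)) \<in> borel_measurable (completion M)"
    by (rule borel_measurable_completion_AE[rotated]) measurable
  have "AE x in M. ennreal (h (path_sup T Z x)) = (SUP n. ennreal (G n x))"
    using lim
  proof eventually_elim
    case (elim x)
    have "incseq (\<lambda>n. ennreal (G n x))" using inc by (intro incseq_SucI ennreal_leI)
    then have "(\<lambda>n. ennreal (G n x)) \<longlonglongrightarrow> (SUP n. ennreal (G n x))" by (rule LIMSEQ_SUP)
    moreover have "(\<lambda>n. ennreal (G n x)) \<longlonglongrightarrow> ennreal (h (path_sup T Z x))"
      using elim by (rule tendsto_ennrealI)
    ultimately show ?case by (rule LIMSEQ_unique[symmetric])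
  qed
  then have "(\<integral>\<^sup>+x. ennreal (h (path_sup T Z x)) \<partial>M) = (\<integral>\<^sup>+x. (SUP n. ennreal (G n x)) \<partial>M)"
    by (rule nn_integral_cong_AE)
  also have "\<dots> = (SUP n. \<integral>\<^sup>+x. ennreal (G n x) \<partial>M)"
    using inc by (intro nn_integral_monotone_convergence_SUP_AE) (auto intro!: AE_I2 ennreal_leI)
  finally show "(\<integral>\<^sup>+x. ennreal (h (path_sup T Z x)) \<partial>M) = (SUP n. \<integral>\<^sup>+x. ennreal (h (Max ((\<lambda>t. Z t x) ` D n))) \<partial>M)"
    unfolding G_def .
qed

lemma gaussian_path_sup_comparison:
  fixes g m :: "real \<Rightarrow> real"
  assumes T: "0 \<le> T"
    and X: "centered_gaussian_process M {0..T} C X" and X_cont: "ae_continuous_paths M T X"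
    and Y: "centered_gaussian_process N {0..T} D Y" and Y_cont: "ae_continuous_paths N T Y"
    and m: "continuous_on {0..T} m"
    and zero: "C 0 0 = 0" "D 0 0 = 0"
    and sym: "\<And>s t. D s t - C s t = D t s - C t s"
    and psd: "\<And>F a. finite F \<Longrightarrow> F \<subseteq> {0..T} \<Longrightarrow> 0 \<le> (\<Sum>s\<in>F. \<Sum>t\<in>F. a s * a t * (D s t - C s t))"
    and g: "mono g" "convex_on UNIV g"
  shows "has_expectation M (\<lambda>x. g (path_sup T (\<lambda>t x. X t x + m t) x))"
    and "has_expectation N (\<lambda>x. g (path_sup T (\<lambda>t x. Y t x + m t) x))"
    and "ext_expectation M (\<lambda>x. g (path_sup T (\<lambda>t x. X t x + m t) x))
      \<le> ext_expectation N (\<lambda>x. g (path_sup T (\<lambda>t x. Y t x + m t) x))"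
proof -
  obtain E where E: "\<And>n. finite (E n)" "\<And>n. 0 \<in> E n" "\<And>n. E n \<subseteq> {0..T}" "incseq E"
    "{0..T} \<subseteq> closure (\<Union>n. E n)"
    by (rule dense_finite_subsets[OF T]) (rule that)
  \<comment> \<open>The processes vanish at time 0, so \<open>g (sup)\<close> is bounded below by \<open>g (m 0)\<close>;
    adding \<open>b\<close> makes it nonnegative.\<close>
  define b where "b = max (- g (m 0)) 0"
  \<comment> \<open>\<open>g\<close> may be unbounded below, so \<open>g + b\<close> is nonnegative
    only at values from \<open>m 0\<close> upwards. Truncation makes \<open>h\<close> nonnegative
    everywhere, keeps it nondecreasing and convex, and almost surely changes nothing at the
    supremum.\<close>
  define h where "h y = max (g y + b) 0" for y
  have h_mono: "mono h" unfolding h_def using monoD[OF g(1)] by (intro monoI max.mono) auto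
  have h_convex: "convex_on UNIV h"
    unfolding h_def by (intro convex_on_max convex_on_add g(2) convex_on_const[THEN iffD2] convex_UNIV)
  have g_cont: "continuous_on UNIV g" using g(2) by (intro convex_on_continuous) auto
  then have h_cont: "continuous_on UNIV h" unfolding h_def by (intro continuous_intros)
  have one: "has_expectation P (\<lambda>x. g (path_sup T (\<lambda>t x. Z t x + m t) x)) \<and>
      ext_expectation P (\<lambda>x. g (path_sup T (\<lambda>t x. Z t x + m t) x))
        = enn2ereal (SUP n. \<integral>\<^sup>+x. ennreal (h (Max ((\<lambda>t. Z t x + m t) ` E n))) \<partial>P) - ereal b"
    if Z: "centered_gaussian_process P {0..T} R Z" and Z_cont: "ae_continuous_paths P T Z" and R: "R 0 0 = 0"
    for P :: "'z measure" and R Z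
  proof -
    have P: "prob_space P" using Z by (simp add: centered_gaussian_process_def gaussian_process_def)
    have meas: "(\<lambda>x. Z t x + m t) \<in> borel_measurable P" if "t \<in> {0..T}" for t
      using centered_gaussian_process_rv[OF Z that] by (auto simp: gaussian_rv_def)
    have cont: "AE x in P. continuous_on {0..T} (\<lambda>t. Z t x + m t)"
      using Z_cont unfolding ae_continuous_paths_def
      by eventually_elim (intro continuous_intros m)
    have "AE x in P. Z 0 x = 0"
      using centered_gaussian_process_zero_variance[OF Z _ R] T by simp
    then have lower: "AE x in P. m 0 \<le> path_sup T (\<lambda>t x. Z t x + m t) x"
      using cont
    proof eventually_elim
      case (elim x)
      have "bdd_above ((\<lambda>t. Z t x + m t) ` {0..T})"
        using elim(2) by (intro bounded_imp_bdd_above compact_imp_bounded compact_continuous_image) auto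
      then have "Z 0 x + m 0 \<le> path_sup T (\<lambda>t x. Z t x + m t) x"
        unfolding path_sup_def using T by (intro cSUP_upper) auto
      then show ?case using elim(1) by simp
    qed
    then have lower_g: "AE x in P. - b \<le> g (path_sup T (\<lambda>t x. Z t x + m t) x)"
    proof eventually_elim
      case (elim x)
      then have "g (m 0) \<le> g (path_sup T (\<lambda>t x. Z t x + m t) x)" by (rule monoD[OF g(1)])
      then show ?case by (auto simp: b_def)
    qed
    \<comment> \<open>Used twice: with \<open>g\<close> for measurability, and with the nonnegative
      \<open>h\<close> for the limit of the integrals.\<close>
    note lim = path_sup_monotone_limit[OF T E meas cont]
    have g_meas: "(\<lambda>x. g (path_sup T (\<lambda>t x. Z t x + m t) x)) \<in> borel_measurable (completion P)"
      by (rule lim(1)[OF _ g(1) g_cont])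
    have b: "0 \<le> b" by (simp add: b_def)
    note shift = ext_expectation_shift[OF P g_meas b lower_g]
    have "(\<integral>\<^sup>+x. ennreal (g (path_sup T (\<lambda>t x. Z t x + m t) x) + b) \<partial>P)
        = (\<integral>\<^sup>+x. ennreal (h (path_sup T (\<lambda>t x. Z t x + m t) x)) \<partial>P)"
      using lower_g by (intro nn_integral_cong_AE) (auto simp: h_def)
    then show ?thesis
      using shift lim(2)[OF _ h_mono h_cont] by simp
  qed
  have "(SUP n. \<integral>\<^sup>+x. ennreal (h (Max ((\<lambda>t. X t x + m t) ` E n))) \<partial>M)
      \<le> (SUP n. \<integral>\<^sup>+x. ennreal (h (Max ((\<lambda>t. Y t x + m t) ` E n))) \<partial>N)"
  proof (intro SUP_mono' gaussian_max_comparison[OF X Y] sym psd h_mono h_convex)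
    show "finite (E n)" "finite (E n)" "E n \<noteq> {}" "E n \<subseteq> {0..T}" "E n \<subseteq> {0..T}" for n
      using E(1-3)[of n] by auto
    show "0 \<le> h y" for y by (simp add: h_def)
  qed
  then show "ext_expectation M (\<lambda>x. g (path_sup T (\<lambda>t x. X t x + m t) x))
      \<le> ext_expectation N (\<lambda>x. g (path_sup T (\<lambda>t x. Y t x + m t) x))"
    using one[OF X X_cont zero(1)] one[OF Y Y_cont zero(2)]
    by (auto intro!: ereal_minus_mono simp: less_eq_ennreal.rep_eq[symmetric])
  show "has_expectation M (\<lambda>x. g (path_sup T (\<lambda>t x. X t x + m t) x))"
    "has_expectation N (\<lambda>x. g (path_sup T (\<lambda>t x. Y t x + m t) x))"
    using one[OF X X_cont zero(1)] one[OF Y Y_cont zero(2)] by auto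
qed

subsection \<open>Bifractional and fractional Brownian motion\<close>

text \<open>After the terms in \<open>\<bar>s - t\<bar>\<close> cancel, the difference is
  \<open>1 / 2 powr K\<close> times the kernel of \<open>powr_kernel_psd\<close> at the points
  \<open>s powr (2 * H)\<close>.\<close>

lemma bifractional_defect_psd:
  assumes K: "0 < K" "K \<le> 1" and F: "F \<subseteq> {0..}"
  shows "0 \<le> (\<Sum>s\<in>F. \<Sum>t\<in>F. a s * a t *
    ((2 powr ((1 - K) / 2))\<^sup>2 * fractional_cov (H * K) s t - bifractional_cov H K s t))"
proof -
  have 2: "(2 powr ((1 - K) / 2))\<^sup>2 * (1 / 2) = 1 / 2 powr K"
    by (simp add: power2_eq_square powr_add[symmetric] powr_diff)
  have "(2 powr ((1 - K) / 2))\<^sup>2 * fractional_cov (H * K) s t - bifractional_cov H K s t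
      = 1 / 2 powr K * ((s powr (2 * H)) powr K + (t powr (2 * H)) powr K
          - (s powr (2 * H) + t powr (2 * H)) powr K)" for s t
    unfolding fractional_cov_def bifractional_cov_def mult.assoc[symmetric] 2
    by (simp add: powr_powr mult.assoc abs_minus_commute add.commute algebra_simps)
  then have "(\<Sum>s\<in>F. \<Sum>t\<in>F. a s * a t *
      ((2 powr ((1 - K) / 2))\<^sup>2 * fractional_cov (H * K) s t - bifractional_cov H K s t))
    = 1 / 2 powr K * (\<Sum>s\<in>F. \<Sum>t\<in>F. a s * a t * ((s powr (2 * H)) powr K + (t powr (2 * H)) powr K
          - (s powr (2 * H) + t powr (2 * H)) powr K))"
    by (simp add: sum_distrib_left mult_ac)
  also have "0 \<le> \<dots>"
    using K by (intro mult_nonneg_nonneg powr_kernel_psd) auto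
  finally show ?thesis .
qed

theorem theorem2p11:
  fixes M :: "'a measure" and N :: "'b measure"
    and W :: "real \<Rightarrow> 'a \<Rightarrow> real" and B Y :: "real \<Rightarrow> 'b \<Rightarrow> real"
    and H K T c :: real and m :: "real \<Rightarrow> real"
  assumes "0 < H" "H < 1" "0 < K" "K \<le> 1" "0 < T"
    and "bifractional_BM M H K W" and "ae_continuous_paths M T W"
    and "fractional_BM N (H * K) B" and "ae_continuous_paths N T B"
    and "\<And>t x. t \<in> {0..T} \<Longrightarrow> Y t x = 2 powr ((1 - K) / 2) * B t x"
    and "continuous_on {0..T} m"
  shows "(has_expectation M (\<lambda>x. max (path_sup T (\<lambda>t x. W t x + m t) x) c) \<and>
         has_expectation N (\<lambda>x. max (path_sup T (\<lambda>t x. Y t x + m t) x) c) \<and>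
         ext_expectation M (\<lambda>x. max (path_sup T (\<lambda>t x. W t x + m t) x) c)
           \<le> ext_expectation N (\<lambda>x. max (path_sup T (\<lambda>t x. Y t x + m t) x) c)) \<and>
         (\<forall>g :: real \<Rightarrow> real. mono g \<and> convex_on UNIV g \<longrightarrow>
         has_expectation M (\<lambda>x. g (path_sup T (\<lambda>t x. W t x + m t) x)) \<and>
         has_expectation N (\<lambda>x. g (path_sup T (\<lambda>t x. Y t x + m t) x)) \<and>
         ext_expectation M (\<lambda>x. g (path_sup T (\<lambda>t x. W t x + m t) x))
           \<le> ext_expectation N (\<lambda>x. g (path_sup T (\<lambda>t x. Y t x + m t) x))) \<and>
         (\<forall>t\<in>{0..T}. tail_integral M (path_sup T W) t \<le> tail_integral N (path_sup T Y) t) \<and>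
         (\<forall>t\<in>{0..T}.
         has_expectation M (\<lambda>x. max (path_sup T W x - t) 0) \<and>
         has_expectation N (\<lambda>x. max (path_sup T Y x - t) 0) \<and>
         ext_expectation M (\<lambda>x. max (path_sup T W x - t) 0)
           \<le> ext_expectation N (\<lambda>x. max (path_sup T Y x - t) 0))"
proof -
  let ?C = "bifractional_cov H K" and ?D = "\<lambda>s t. (2 powr ((1 - K) / 2))\<^sup>2 * fractional_cov (H * K) s t"
  have W: "centered_gaussian_process M {0..T} ?C W"
    using centered_gaussian_process_scale[of M "{0..}" ?C W "{0..T}" W 1] assms(6)
    by (auto simp: bifractional_BM_def)
  have Y: "centered_gaussian_process N {0..T} ?D Y"
    using assms(8,10) by (intro centered_gaussian_process_scale[of N "{0..}" _ B]) (auto simp: fractional_BM_def)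
  have Y_cont: "ae_continuous_paths N T Y"
    using assms(9) unfolding ae_continuous_paths_def
  proof eventually_elim
    case (elim x)
    then have "continuous_on {0..T} (\<lambda>t. 2 powr ((1 - K) / 2) * B t x)" by (intro continuous_intros)
    then show ?case using assms(10) by (subst continuous_on_cong[OF refl]) auto
  qed
  have sym: "?D s t - ?C s t = ?D t s - ?C t s" for s t
    by (simp add: fractional_cov_def bifractional_cov_def abs_minus_commute add.commute)
  have psd: "0 \<le> (\<Sum>s\<in>F. \<Sum>t\<in>F. a s * a t * (?D s t - ?C s t))" if "finite F" "F \<subseteq> {0..T}" for F a
    using that assms(3,4) by (intro bifractional_defect_psd) auto
  have zero: "?C 0 0 = 0" "?D 0 0 = 0"
    by (auto simp: fractional_cov_def bifractional_cov_def)
  note compare = gaussian_path_sup_comparison[OF less_imp_le[OF assms(5)] W assms(7) Y Y_cont _ zero sym psd]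
  have drift: "has_expectation M (\<lambda>x. g (path_sup T (\<lambda>t x. W t x + m t) x)) \<and>
      has_expectation N (\<lambda>x. g (path_sup T (\<lambda>t x. Y t x + m t) x)) \<and>
      ext_expectation M (\<lambda>x. g (path_sup T (\<lambda>t x. W t x + m t) x))
        \<le> ext_expectation N (\<lambda>x. g (path_sup T (\<lambda>t x. Y t x + m t) x))"
    if "mono g" "convex_on UNIV g" "continuous_on {0..T} m" for g m
    using compare[OF that(3) _ _ that(1,2)] by blast
  \<comment> \<open>With \<open>r = 0\<close> this family gives the truncation at \<open>c\<close>;
    with \<open>r = t\<close>, lower level 0 and zero drift it gives the positive part.\<close>
  have max_mono: "mono (\<lambda>y. max (y - r) c)" for r c :: real by (intro monoI max.mono) auto
  have max_convex: "convex_on UNIV (\<lambda>y. max (y - r) c)" for r c :: real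
  proof (rule convex_on_max)
    show "convex_on UNIV (\<lambda>y. y - r)" by (rule convex_onI) (simp_all add: algebra_simps)
  qed (simp add: convex_on_const)
  have no_drift: "has_expectation M (\<lambda>x. max (path_sup T W x - t) 0) \<and>
      has_expectation N (\<lambda>x. max (path_sup T Y x - t) 0) \<and>
      ext_expectation M (\<lambda>x. max (path_sup T W x - t) 0)
        \<le> ext_expectation N (\<lambda>x. max (path_sup T Y x - t) 0)" for t
    using drift[OF max_mono max_convex, of "\<lambda>_. 0"] by simp
  have tail: "tail_integral M (path_sup T W) t \<le> tail_integral N (path_sup T Y) t" for t
  proof -
    \<comment> \<open>The comparison for the identity is invoked only because
      \<open>has_expectation\<close> contains measurability of the path supremum.\<close>
    have id: "mono (\<lambda>y::real. y)" "convex_on UNIV (\<lambda>y::real. y)" by (auto simp: mono_def convex_on_def)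
    have "path_sup T W \<in> borel_measurable (completion M)" "path_sup T Y \<in> borel_measurable (completion N)"
      using drift[OF id, of "\<lambda>_. 0"] by (simp_all add: has_expectation_def)
    moreover have "prob_space M" "prob_space N"
      using W Y by (auto simp: centered_gaussian_process_def gaussian_process_def)
    ultimately have "tail_integral M (path_sup T W) t = (\<integral>\<^sup>+x. ennreal (path_sup T W x - t) \<partial>completion M)"
      "tail_integral N (path_sup T Y) t = (\<integral>\<^sup>+x. ennreal (path_sup T Y x - t) \<partial>completion N)"
      by (simp_all only: tail_integral_eq)
    \<comment> \<open>The positive part has no negative part, so its extended expectation is exactly
      the integral that the tail integral was rewritten to.\<close>
    moreover have "ennreal (max z 0) = ennreal z" "ennreal (- max z 0) = 0" for z
      by (auto simp: max_def ennreal_neg)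
    ultimately show ?thesis
      using no_drift[of t] by (simp add: ext_expectation_def less_eq_ennreal.rep_eq zero_ennreal.rep_eq)
  qed
  show ?thesis
    using drift[OF max_mono[of 0 c] max_convex[of 0 c] assms(11)] drift[OF _ _ assms(11)] no_drift tail by simp
qed

end
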